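(* Let $\{W(t), t\in\mathbb{R}^d\}$ be a zero-mean Gaussian process with stationary increments, variance $\sigma^2(t)=\operatorname{Var} W(t)$ and variogram $\gamma(t)$, and let $W_i$, $i\in\mathbb{N}$, be independent copies of $W$. Independently of the $W_i$, let $\sum_{i=1}^\infty \delta_{U_i}$ be a Poisson point process on $\mathbb{R}$ with intensity $e^{-y}\,dy$. Then the process $$\eta(t)=\bigvee_{i=1}^\infty \bigl(U_i+W_i(t)-\sigma^2(t)/2\bigr),\qquad t\in\mathbb{R}^d,$$ is a stationary max-stable process with standard Gumbel margins. Moreover, the law of $\eta$ depends only on the variogram $\gamma$; that is, two zero-mean Gaussian processes with stationary increments having the same variogram (but possibly different variances) yield processes $\eta$ with the same law.
   Context: A process $\{W(t),t\in\mathbb{R}^d\}$ has stationary increments if the law of $\{W(t+t_0)-W(t_0),t\in\mathbb{R}^d\}$ does not depend on $t_0\in\mathbb{R}^d$. Gaussian processes with stationary increments are always assumed to have zero mean. The variogram of such a process is $\gamma(t)=\mathbb{E}(W(t+t_0)-W(t_0))^2$ (independent of $t_0$). $\bigvee$ denotes the supremum. The law of a process on $\mathbb{R}^d$ means its finite-dimensional distributions. A process $\{\eta(t),t\in\mathbb{R}^d\}$ is max-stable if for every $n\in\mathbb{N}$ the process $\{\bigvee_{k=1}^n\eta_k(t)\}$ has the same law as $\{\eta(t)+\log n\}$, where $\eta_1,\dots,\eta_n$ are independent copies of $\eta$. Stationary means that the law of $\{\eta(t+h),t\in\mathbb{R}^d\}$ does not depend on $h\in\mathbb{R}^d$. The standard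 Gumbel distribution has distribution function $y\mapsto\exp(-e^{-y})$. *)

theory Defs
  imports "HOL-Probability.Probability"
begin

text \<open>Processes indexed by \<open>'i\<close> are curried functions \<open>X t \<omega>\<close>; values may be real or extended real.\<close>

definition stoch_process :: "'a measure \<Rightarrow> ('i \<Rightarrow> 'a \<Rightarrow> 'b::topological_space) \<Rightarrow> bool" where
  "stoch_process M X \<longleftrightarrow> prob_space M \<and> (\<forall>t. X t \<in> borel_measurable M)"

text \<open>Measurability is part of the predicate because \<open>distr\<close> is meaningless for
  non-measurable maps.\<close>

definition same_law ::
  "'a measure \<Rightarrow> ('i \<Rightarrow> 'a \<Rightarrow> 'b::topological_space) \<Rightarrow> 'c measure \<Rightarrow> ('i \<Rightarrow> 'c \<Rightarrow> 'b) \<Rightarrow> bool" where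
  "same_law M X N Y \<longleftrightarrow> stoch_process M X \<and> stoch_process N Y \<and>
     (\<forall>T. finite T \<longrightarrow>
        distr M (Pi\<^sub>M T (\<lambda>_. borel)) (\<lambda>\<omega>. \<lambda>t\<in>T. X t \<omega>) =
        distr N (Pi\<^sub>M T (\<lambda>_. borel)) (\<lambda>\<omega>. \<lambda>t\<in>T. Y t \<omega>))"

definition process_algebra ::
  "'a measure \<Rightarrow> ('i \<Rightarrow> 'a \<Rightarrow> 'b::topological_space) \<Rightarrow> 'a set set" where
  "process_algebra M X =
     sets (vimage_algebra (space M) (\<lambda>\<omega> t. X t \<omega>) (Pi\<^sub>M UNIV (\<lambda>_. borel)))"

definition indep_copies ::
  "'a measure \<Rightarrow> 'k set \<Rightarrow> ('k \<Rightarrow> 'i \<Rightarrow> 'a \<Rightarrow> 'b::topological_space) \<Rightarrow>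
   'c measure \<Rightarrow> ('i \<Rightarrow> 'c \<Rightarrow> 'b) \<Rightarrow> bool" where
  "indep_copies M K Y N X \<longleftrightarrow> prob_space M \<and> (\<forall>k\<in>K. same_law M (Y k) N X) \<and>
     prob_space.indep_vars M (\<lambda>_. Pi\<^sub>M UNIV (\<lambda>_. borel)) (\<lambda>k \<omega> t. Y k t \<omega>) K"

text \<open>Degenerate (almost surely constant) variables count as Gaussian.\<close>

definition gaussian_rv :: "'a measure \<Rightarrow> ('a \<Rightarrow> real) \<Rightarrow> bool" where
  "gaussian_rv M Z \<longleftrightarrow> Z \<in> borel_measurable M \<and>
     (\<exists>\<mu>. (AE \<omega> in M. Z \<omega> = \<mu>) \<or> (\<exists>\<sigma>>0. distributed M lborel Z (normal_density \<mu> \<sigma>)))"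

definition gaussian_process :: "'a measure \<Rightarrow> ('i \<Rightarrow> 'a \<Rightarrow> real) \<Rightarrow> bool" where
  "gaussian_process M X \<longleftrightarrow> stoch_process M X \<and>
     (\<forall>T a. finite T \<longrightarrow> gaussian_rv M (\<lambda>\<omega>. \<Sum>t\<in>T. a t * X t \<omega>))"

definition stationary_increments :: "'a measure \<Rightarrow> ('t::ab_group_add \<Rightarrow> 'a \<Rightarrow> real) \<Rightarrow> bool" where
  "stationary_increments M X \<longleftrightarrow>
     (\<forall>s s'. same_law M (\<lambda>t \<omega>. X (t + s) \<omega> - X s \<omega>) M (\<lambda>t \<omega>. X (t + s') \<omega> - X s' \<omega>))"

definition centered_gaussian_si :: "'a measure \<Rightarrow> ('t::ab_group_add \<Rightarrow> 'a \<Rightarrow> real) \<Rightarrow> bool" where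
  "centered_gaussian_si M X \<longleftrightarrow> gaussian_process M X \<and>
     (\<forall>t. prob_space.expectation M (X t) = 0) \<and> stationary_increments M X"

text \<open>For stationary increments, the second moment of \<open>X (t + s) - X s\<close> does not depend on \<open>s\<close>;
  the choice \<open>s = 0\<close> is made here.\<close>

definition variogram :: "'a measure \<Rightarrow> ('t::ab_group_add \<Rightarrow> 'a \<Rightarrow> real) \<Rightarrow> 't \<Rightarrow> real" where
  "variogram M X t = prob_space.expectation M (\<lambda>\<omega>. (X t \<omega> - X 0 \<omega>)\<^sup>2)"

definition point_count :: "(nat \<Rightarrow> 'a \<Rightarrow> real) \<Rightarrow> real set \<Rightarrow> 'a \<Rightarrow> ennreal" where
  "point_count U B \<omega> = (\<Sum>i. indicator B (U i \<omega>))"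

definition poisson_point_process :: "'a measure \<Rightarrow> (nat \<Rightarrow> 'a \<Rightarrow> real) \<Rightarrow> real measure \<Rightarrow> bool" where
  "poisson_point_process M U \<Lambda> \<longleftrightarrow> stoch_process M U \<and>
     (\<forall>B\<in>sets borel. emeasure \<Lambda> B < \<infinity> \<longrightarrow>
        (\<forall>k::nat. prob_space.prob M {\<omega> \<in> space M. point_count U B \<omega> = of_nat k} =
           exp (- measure \<Lambda> B) * measure \<Lambda> B ^ k / fact k)) \<and>
     (\<forall>B\<in>sets borel. emeasure \<Lambda> B = \<infinity> \<longrightarrow> (AE \<omega> in M. point_count U B \<omega> = \<infinity>)) \<and>
     (\<forall>(n::nat) B. (\<forall>j<n. B j \<in> sets borel) \<and> disjoint_family_on B {..<n} \<longrightarrow>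
        prob_space.indep_vars M (\<lambda>_. borel) (\<lambda>j. point_count U (B j)) {..<n})"

text \<open>Extended real values avoid presupposing that the supremum is finite.\<close>

definition sup_process ::
  "'c measure \<Rightarrow> ('t \<Rightarrow> 'c \<Rightarrow> real) \<Rightarrow> (nat \<Rightarrow> 'a \<Rightarrow> real) \<Rightarrow> (nat \<Rightarrow> 't \<Rightarrow> 'a \<Rightarrow> real) \<Rightarrow>
   't \<Rightarrow> 'a \<Rightarrow> ereal" where
  "sup_process P W U V t \<omega> =
     (SUP i. ereal (U i \<omega> + V i t \<omega> - prob_space.variance P (W t) / 2))"

definition stationary_process ::
  "'a measure \<Rightarrow> ('t::ab_group_add \<Rightarrow> 'a \<Rightarrow> 'b::topological_space) \<Rightarrow> bool" where
  "stationary_process M X \<longleftrightarrow>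
     (\<forall>h h'. same_law M (\<lambda>t. X (t + h)) M (\<lambda>t. X (t + h')))"

text \<open>The independent copies live on an arbitrary probability space whose underlying type is
  supplied by the type argument.  They always exist for \<open>TYPE(nat \<Rightarrow> 'a)\<close> (coordinates of a
  product space), so a statement for every type argument is not vacuous.\<close>

definition max_stable :: "'c itself \<Rightarrow> 'a measure \<Rightarrow> ('t \<Rightarrow> 'a \<Rightarrow> ereal) \<Rightarrow> bool" where
  "max_stable _ M X \<longleftrightarrow> stoch_process M X \<and>
     (\<forall>n\<ge>1. \<forall>(N :: 'c measure) Y. indep_copies N {..<n::nat} Y M X \<longrightarrow>
        same_law N (\<lambda>t \<omega>. SUP k\<in>{..<n}. Y k t \<omega>) M (\<lambda>t \<omega>. X t \<omega> + ereal (ln (real n))))"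

text \<open>This forces finiteness almost surely: let \<open>y\<close> tend to \<open>\<plusminus>\<infinity>\<close>.\<close>

definition standard_gumbel :: "'a measure \<Rightarrow> ('a \<Rightarrow> ereal) \<Rightarrow> bool" where
  "standard_gumbel M Z \<longleftrightarrow> Z \<in> borel_measurable M \<and>
     (\<forall>y::real. prob_space.prob M {\<omega> \<in> space M. Z \<omega> \<le> ereal y} = exp (- exp (- y)))"

definition exp_intensity :: "real measure" where
  "exp_intensity = density lborel (\<lambda>y. ennreal (exp (- y)))"

end

theory Submission
  imports Defs "HOL-Complex_Analysis.Cauchy_Integral_Formula"
begin

text \<open>Conditioning on the points \<open>U i\<close> and using the Laplace functional of the Poisson process,
  the event that \<open>\<eta> t \<le> y t\<close> for all \<open>t\<close> in a finite set \<open>S\<close> has probability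
  \<open>exp (- E max exp (W t - Var (W t) / 2 - y t))\<close>, the maximum being over \<open>S\<close>. Everything follows
  once this exponent is seen to depend only on the variogram. Fix \<open>t0\<close> in \<open>S\<close> and tilt the measure
  by the density \<open>exp (Y t0)\<close>, where \<open>Y t = W t - Var (W t) / 2\<close>. The exponent becomes the tilted
  expectation of \<open>max exp (Y t - Y t0 - y t)\<close>, and the Laplace transform of the family
  \<open>Y t - Y t0\<close> under the tilted measure involves only the second moments of the increments of
  \<open>W\<close>. Since an everywhere finite Laplace transform determines a finite measure,
  these second moments determine the exponent.\<close>

subsection \<open>Laplace transforms determine finite measures\<close>

text \<open>The law of \<open>Y\<close> depends on the variances, so the variogram cannot enter by
  comparing the families \<open>Y\<close> directly. Factoring \<open>exp (Y t0)\<close> out of the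
  maximum leaves a function of differences only; the drift \<open>- Var (W t) / 2\<close> gives this
  factor expectation one and makes the variances cancel. The differences may be degenerate Gaussian
  vectors without a joint density, whereas their Laplace transform is always available, every linear
  combination of \<open>W\<close> being Gaussian or constant. The Poisson process is given through
  independent counts, while its points come as a sequence whose single terms have no prescribed law.
  Its Laplace functional is therefore a limit of products over the first \<open>k\<close> points.
  The expectation of such a product is the probability that the first \<open>k\<close> marked points
  respect the bounds: a point at height \<open>u\<close> breaks one with probability
  \<open>h u\<close>, and given the points the marks are independent.\<close>

lemma exp_mgf_sums:
  fixes z :: "'b::{real_normed_field,banach,second_countable_topology}" and M :: "real measure"
  assumes [measurable_cong]: "sets M = sets borel"
    and int: "\<And>s. integrable M (\<lambda>x. exp (s * x))"
  shows "(\<lambda>n. of_real (\<integral>x. x ^ n / fact n \<partial>M) * z ^ n) sums (\<integral>x. exp (z * of_real x) \<partial>M)"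
proof -
  \<comment> \<open>\<open>w\<close> dominates every partial sum, since those are at most
    \<open>exp (norm z * \<bar>x\<bar>)\<close>. The field stays generic because the expansion is
    used at real \<open>z\<close>, to read off the moments, and at imaginary \<open>z\<close>, to
    rebuild the characteristic function.\<close>
  define w where "w x = exp (norm z * x) + exp (- norm z * x)" for x :: real
  have iw: "integrable M w" unfolding w_def by (intro Bochner_Integration.integrable_add int)
  have mom: "integrable M (\<lambda>x. x ^ n / fact n)" for n
  proof (rule Bochner_Integration.integrable_bound)
    show "integrable M (\<lambda>x. exp (1 * x) + exp (- 1 * x))"
      by (intro Bochner_Integration.integrable_add int)
    show "AE x in M. norm (x ^ n / fact n) \<le> norm (exp (1 * x) + exp (- 1 * x))"
    proof (intro AE_I2)
      fix x :: real
      have "norm (x ^ n / fact n) = \<bar>x\<bar> ^ n / fact n" by (simp add: power_abs)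
      also have "\<dots> \<le> exp \<bar>x\<bar>"
        using sum_le_suminf[OF summable_exp, of "{n}" "\<bar>x\<bar>"] by (simp add: exp_def field_simps)
      also have "\<dots> \<le> exp (1 * x) + exp (- 1 * x)" by (auto simp: abs_if)
      finally show "norm (x ^ n / fact n) \<le> norm (exp (1 * x) + exp (- 1 * x))" by simp
    qed
  qed measurable
  have "(\<lambda>k. \<integral>x. (\<Sum>n<k. of_real (x ^ n / fact n) * z ^ n) \<partial>M) \<longlonglongrightarrow> (\<integral>x. exp (z * of_real x) \<partial>M)"
  proof (rule integral_dominated_convergence[OF _ _ iw])
    show "AE x in M. (\<lambda>k. \<Sum>n<k. of_real (x ^ n / fact n) * z ^ n) \<longlonglongrightarrow> exp (z * of_real x)"
    proof (intro AE_I2)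
      fix x :: real
      have "(\<lambda>n. of_real (x ^ n / fact n) * z ^ n) = (\<lambda>n. (z * of_real x) ^ n /\<^sub>R fact n)"
        by (auto simp: fun_eq_iff scaleR_conv_of_real power_mult_distrib field_simps)
      then show "(\<lambda>k. \<Sum>n<k. of_real (x ^ n / fact n) * z ^ n) \<longlonglongrightarrow> exp (z * of_real x)"
        using exp_converges[of "z * of_real x"] unfolding sums_def by (simp only:)
    qed
    fix k
    show "AE x in M. norm (\<Sum>n<k. of_real (x ^ n / fact n) * z ^ n) \<le> w x"
    proof (intro AE_I2)
      fix x :: real
      have "norm (\<Sum>n<k. of_real (x ^ n / fact n) * z ^ n) \<le> (\<Sum>n<k. norm (of_real (x ^ n / fact n) * z ^ n))"
        by (rule norm_sum)
      also have "\<dots> = (\<Sum>n<k. (norm z * \<bar>x\<bar>) ^ n /\<^sub>R fact n)"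
        by (intro sum.cong) (auto simp: norm_mult norm_power power_abs power_mult_distrib norm_divide field_simps)
      also have "\<dots> \<le> exp (norm z * \<bar>x\<bar>)"
        unfolding exp_def by (intro sum_le_suminf summable_exp_generic) auto
      also have "\<dots> \<le> w x" by (auto simp: abs_if w_def)
      finally show "norm (\<Sum>n<k. of_real (x ^ n / fact n) * z ^ n) \<le> w x" .
    qed
  qed measurable
  also have "(\<lambda>k. \<integral>x. (\<Sum>n<k. of_real (x ^ n / fact n) * z ^ n) \<partial>M)
     = (\<lambda>k. \<Sum>n<k. of_real (\<integral>x. x ^ n / fact n \<partial>M) * z ^ n)"
  proof
    fix k
    have i: "integrable M (\<lambda>x. of_real (x ^ n / fact n) * z ^ n)" for n
      by (intro integrable_mult_left integrable_of_real mom)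
    have e: "(\<integral>x. of_real (x ^ n / fact n) * z ^ n \<partial>M) = of_real (\<integral>x. x ^ n / fact n \<partial>M) * z ^ n" for n
      using Bochner_Integration.integral_mult_left[where f = "\<lambda>x. of_real (x ^ n / fact n)" and c = "z ^ n" and M = M,
        OF integrable_of_real[OF mom]]
      by (simp only: integral_bounded_linear[OF bounded_linear_of_real mom])
    show "(\<integral>x. (\<Sum>n<k. of_real (x ^ n / fact n) * z ^ n) \<partial>M)
      = (\<Sum>n<k. of_real (\<integral>x. x ^ n / fact n \<partial>M) * z ^ n)"
      by (subst Bochner_Integration.integral_sum) (rule i, simp only: e)
  qed
  finally show ?thesis by (simp add: sums_def)
qed

lemma powser_coeffs_unique:
  fixes a b :: "nat \<Rightarrow> real"
  assumes "\<And>x. (\<lambda>n. a n * x ^ n) sums f x" "\<And>x. (\<lambda>n. b n * x ^ n) sums f x"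
  shows "a = b"
proof (rule ccontr)
  assume "a \<noteq> b"
  then obtain m where m: "a m - b m \<noteq> 0" by auto
  have s: "(\<lambda>n. (a n - b n) * x ^ n) sums 0" for x
    using sums_diff[OF assms(1)[of x] assms(2)[of x]] by (simp add: algebra_simps)
  have "a 0 - b 0 = 0"
    using s[of 0] powser_sums_zero_iff[of "\<lambda>n. a n - b n" 0] by simp
  with m have "m > 0" by (cases m) auto
  \<comment> \<open>A nonzero coefficient of positive index would isolate the zero at the origin,
    which is absurd for the zero function.\<close>
  obtain r where "r > 0" and r: "\<And>z::real. z \<in> cball 0 r - {0} \<Longrightarrow> (0::real) \<noteq> 0"
    by (rule powser_0_nonzero[of 1 "0::real" "\<lambda>n. a n - b n" "\<lambda>_. 0" m]) (use s m \<open>m > 0\<close> in auto)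
  from r[of r] \<open>r > 0\<close> show False by auto
qed

text \<open>The real transform determines all moments, as the coefficients of its power series. The
  same series at imaginary arguments is the characteristic function, and Levy's uniqueness theorem
  concludes.\<close>

lemma real_distribution_eqI_mgf:
  assumes "real_distribution M" "real_distribution N"
    and "\<And>s. integrable M (\<lambda>x. exp (s * x))" "\<And>s. integrable N (\<lambda>x. exp (s * x))"
    and eq: "\<And>s. (\<integral>x. exp (s * x) \<partial>M) = (\<integral>x. exp (s * x) \<partial>N)"
  shows "M = N"
proof -
  interpret M: real_distribution M by fact
  interpret N: real_distribution N by fact
  have "(\<lambda>n. \<integral>x. x ^ n / fact n \<partial>M) = (\<lambda>n. \<integral>x. x ^ n / fact n \<partial>N)"
  proof (rule powser_coeffs_unique)
    fix s :: real
    show "(\<lambda>n. (\<integral>x. x ^ n / fact n \<partial>M) * s ^ n) sums (\<integral>x. exp (s * x) \<partial>M)"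
      using exp_mgf_sums[of M s] assms by simp
    show "(\<lambda>n. (\<integral>x. x ^ n / fact n \<partial>N) * s ^ n) sums (\<integral>x. exp (s * x) \<partial>M)"
      using exp_mgf_sums[of N s] assms by simp
  qed
  then have mom: "(\<integral>x. x ^ n / fact n \<partial>M) = (\<integral>x. x ^ n / fact n \<partial>N)" for n
    by (simp add: fun_eq_iff)
  have "char M t = char N t" for t
  proof -
    have "(\<integral>x. exp ((\<i> * of_real t) * of_real x) \<partial>M) = (\<integral>x. exp ((\<i> * of_real t) * of_real x) \<partial>N)"
      using exp_mgf_sums[of M "\<i> * of_real t"] exp_mgf_sums[of N "\<i> * of_real t"] assms
      unfolding mom by (intro sums_unique2) auto
    then show ?thesis by (simp add: char_def mult_ac)
  qed
  then show ?thesis by (intro Levy_uniqueness assms) auto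
qed

text \<open>The transform at \<open>0\<close> is the total mass, so both measures can be normalised
  by the same constant; mass zero is treated apart. The lemma is meant for laws weighted by
  densities, which are not probability measures.\<close>

lemma measure_eqI_mgf:
  fixes M N :: "real measure"
  assumes sM[measurable_cong]: "sets M = sets borel" and sN[measurable_cong]: "sets N = sets borel"
    and fin: "\<And>s. (\<integral>\<^sup>+x. ennreal (exp (s * x)) \<partial>M) < \<infinity>"
    and eq: "\<And>s. (\<integral>\<^sup>+x. ennreal (exp (s * x)) \<partial>M) = (\<integral>\<^sup>+x. ennreal (exp (s * x)) \<partial>N)"
  shows "M = N"
proof -
  define c where "c = emeasure M (space M)"
  have c: "c < \<infinity>" "emeasure N (space N) = c"
    using fin[of 0] eq[of 0] by (simp_all add: c_def)
  show ?thesis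
  proof (cases "c = 0")
    case True
    show ?thesis
    proof (rule measure_eqI)
      fix A assume "A \<in> sets M"
      then show "emeasure M A = emeasure N A"
        using emeasure_mono[of A "space M" M] emeasure_mono[of A "space N" N] True c
        by (simp add: c_def sM sN sets_eq_imp_space_eq[OF sM] sets_eq_imp_space_eq[OF sN])
    qed (simp add: sM sN)
  next
    case False
    obtain r where r: "c = ennreal r" "r > 0"
      using False c(1) by (cases c) (auto simp: less_le)
    define k where "k = ennreal (1 / r)"
    have k: "k * c = 1" "k < \<infinity>" "k \<noteq> 0"
      using r by (auto simp: k_def ennreal_mult[symmetric])
    have rd: "real_distribution (scale_measure k L)" if "sets L = sets borel" "emeasure L (space L) = c" for L
      using that k sets_eq_imp_space_eq[of L borel]
      by (intro real_distribution.intro prob_spaceI real_distribution_axioms.intro) (auto simp: space_scale_measure)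
    have int: "integrable (scale_measure k L) (\<lambda>x. exp (s * x))"
      if [measurable_cong]: "sets L = sets borel" and "(\<integral>\<^sup>+x. ennreal (exp (s * x)) \<partial>L) < \<infinity>" for L s
      using that k by (auto simp: integrable_iff_bounded nn_integral_scale_measure ennreal_mult_less_top)
    have "scale_measure k M = scale_measure k N"
    proof (rule real_distribution_eqI_mgf)
      show "(\<integral>x. exp (s * x) \<partial>scale_measure k M) = (\<integral>x. exp (s * x) \<partial>scale_measure k N)" for s
        by (subst (1 2) integral_eq_nn_integral) (auto simp: nn_integral_scale_measure eq)
    qed (use rd int sM sN c eq fin in \<open>auto simp: c_def\<close>)
    then have "k * emeasure M A = k * emeasure N A" for A
      by (metis emeasure_scale_measure)
    then have "emeasure M A = emeasure N A" for A
      using k(2,3) by (auto simp: ennreal_mult_cancel_left)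
    then show ?thesis by (intro measure_eqI) (auto simp: sM sN)
  qed
qed

text \<open>One coordinate at a time, the exponential weight \<open>exp (a t * X t)\<close> is replaced by the
  indicator of \<open>X t \<in> A t\<close>: for the remaining weights fixed, the one-dimensional uniqueness theorem
  applies to the weighted law of \<open>X t\<close>. All weights are nonnegative, so no signed measures occur.\<close>

lemma distr_PiM_eqI_mgf:
  fixes X :: "'i \<Rightarrow> 'a \<Rightarrow> real" and Y :: "'i \<Rightarrow> 'b \<Rightarrow> real"
  assumes T: "finite T"
    and X[measurable]: "\<And>t. t \<in> T \<Longrightarrow> X t \<in> borel_measurable M"
    and Y[measurable]: "\<And>t. t \<in> T \<Longrightarrow> Y t \<in> borel_measurable N"
    and fin: "\<And>a. (\<integral>\<^sup>+\<omega>. ennreal (exp (\<Sum>t\<in>T. a t * X t \<omega>)) \<partial>M) < \<infinity>"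
    and eq: "\<And>a. (\<integral>\<^sup>+\<omega>. ennreal (exp (\<Sum>t\<in>T. a t * X t \<omega>)) \<partial>M)
                 = (\<integral>\<^sup>+\<omega>. ennreal (exp (\<Sum>t\<in>T. a t * Y t \<omega>)) \<partial>N)"
  shows "distr M (Pi\<^sub>M T (\<lambda>_. borel)) (\<lambda>\<omega>. \<lambda>t\<in>T. X t \<omega>) = distr N (Pi\<^sub>M T (\<lambda>_. borel)) (\<lambda>\<omega>. \<lambda>t\<in>T. Y t \<omega>)"
proof -
  define ind :: "'i set \<Rightarrow> ('i \<Rightarrow> real set) \<Rightarrow> ('i \<Rightarrow> real) \<Rightarrow> ennreal"
    where "ind S A x = (\<Prod>t\<in>S. indicator (A t) (x t))" for S A x
  have ind_le: "ind S A x \<le> 1" for S A x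
    unfolding ind_def by (intro prod_le_1) (auto simp: indicator_def)
  have mX[measurable]: "(\<lambda>\<omega>. ind S A (\<lambda>t. X t \<omega>)) \<in> borel_measurable M"
    if "S \<subseteq> T" "\<And>t. A t \<in> sets borel" for S A
    unfolding ind_def using that by (intro borel_measurable_prod_ennreal) (auto intro!: borel_measurable_indicator' X)
  have mY[measurable]: "(\<lambda>\<omega>. ind S A (\<lambda>t. Y t \<omega>)) \<in> borel_measurable N"
    if "S \<subseteq> T" "\<And>t. A t \<in> sets borel" for S A
    unfolding ind_def using that by (intro borel_measurable_prod_ennreal) (auto intro!: borel_measurable_indicator' Y)
  have main: "(\<integral>\<^sup>+\<omega>. ind S A (\<lambda>t. X t \<omega>) * ennreal (exp (\<Sum>t\<in>T - S. a t * X t \<omega>)) \<partial>M)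
            = (\<integral>\<^sup>+\<omega>. ind S A (\<lambda>t. Y t \<omega>) * ennreal (exp (\<Sum>t\<in>T - S. a t * Y t \<omega>)) \<partial>N)"
    if "S \<subseteq> T" "\<And>t. A t \<in> sets borel" for S A a
    using finite_subset[OF that(1) T] that(1) that(2)
  proof (induction S arbitrary: a rule: finite_induct)
    case empty
    show ?case using eq[of a] by (simp add: ind_def)
  next
    case (insert u S)
    note A[measurable] = \<open>\<And>t. A t \<in> sets borel\<close>
    have S: "S \<subseteq> T" "u \<in> T" and [measurable]: "X u \<in> borel_measurable M" "Y u \<in> borel_measurable N"
      using insert.prems X Y by auto
    \<comment> \<open>\<open>wX\<close> collects the indicators already in place and the exponential
      weights of the coordinates still untouched, without \<open>u\<close>. Letting only the weight
      \<open>s\<close> at \<open>u\<close> vary traces out the Laplace transform of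
      \<open>X u\<close> under this density, which is why the induction keeps \<open>a\<close>
      arbitrary.\<close>
    define wX where "wX \<omega> = ind S A (\<lambda>t. X t \<omega>) * ennreal (exp (\<Sum>t\<in>T - insert u S. a t * X t \<omega>))" for \<omega>
    define wY where "wY \<omega> = ind S A (\<lambda>t. Y t \<omega>) * ennreal (exp (\<Sum>t\<in>T - insert u S. a t * Y t \<omega>))" for \<omega>
    have [measurable]: "wX \<in> borel_measurable M"
      unfolding wX_def
      by (intro borel_measurable_times_ennreal mX S A measurable_compose[OF _ measurable_ennreal] borel_measurable_exp
          measurable_compose[OF _ borel_measurable_exp] borel_measurable_sum borel_measurable_times X) auto
    have [measurable]: "wY \<in> borel_measurable N"
      unfolding wY_def
      by (intro borel_measurable_times_ennreal mY S A measurable_compose[OF _ measurable_ennreal] borel_measurable_exp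
          measurable_compose[OF _ borel_measurable_exp] borel_measurable_sum borel_measurable_times Y) auto
    have split: "(\<Sum>t\<in>T - S. (a(u := s)) t * f t) = s * f u + (\<Sum>t\<in>T - insert u S. a t * f t)" for s and f :: "'i \<Rightarrow> real"
    proof -
      have "(\<Sum>t\<in>T - S. (a(u := s)) t * f t) = s * f u + (\<Sum>t\<in>T - S - {u}. (a(u := s)) t * f t)"
        using S insert.hyps T by (subst sum.remove[of _ u]) auto
      also have "(\<Sum>t\<in>T - S - {u}. (a(u := s)) t * f t) = (\<Sum>t\<in>T - insert u S. a t * f t)"
        by (intro sum.cong) auto
      finally show ?thesis .
    qed
    let ?MX = "distr (density M wX) borel (X u)" and ?MY = "distr (density N wY) borel (Y u)"
    have eX: "(\<integral>\<^sup>+x. ennreal (exp (s * x)) \<partial>?MX)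
       = (\<integral>\<^sup>+\<omega>. ind S A (\<lambda>t. X t \<omega>) * ennreal (exp (\<Sum>t\<in>T - S. (a(u := s)) t * X t \<omega>)) \<partial>M)" for s
      unfolding split by (subst nn_integral_distr; simp add: nn_integral_density)
        (simp add: wX_def exp_add ennreal_mult mult_ac)
    have eY: "(\<integral>\<^sup>+x. ennreal (exp (s * x)) \<partial>?MY)
       = (\<integral>\<^sup>+\<omega>. ind S A (\<lambda>t. Y t \<omega>) * ennreal (exp (\<Sum>t\<in>T - S. (a(u := s)) t * Y t \<omega>)) \<partial>N)" for s
      unfolding split by (subst nn_integral_distr; simp add: nn_integral_density)
        (simp add: wY_def exp_add ennreal_mult mult_ac)
    have "?MX = ?MY"
    proof (rule measure_eqI_mgf)
      fix s :: real
      show "(\<integral>\<^sup>+x. ennreal (exp (s * x)) \<partial>?MX) = (\<integral>\<^sup>+x. ennreal (exp (s * x)) \<partial>?MY)"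
        unfolding eX eY by (rule insert.IH[OF S(1) A])
      \<comment> \<open>Indicators are at most one; dropping them leaves a transform whose weights
        vanish on \<open>S\<close>, and \<open>fin\<close> bounds it.\<close>
      define b where "b = (\<lambda>t. if t \<in> S then 0 else (a(u := s)) t)"
      have "(\<Sum>t\<in>T - S. (a(u := s)) t * X t \<omega>) = (\<Sum>t\<in>T. b t * X t \<omega>)" for \<omega>
        using T by (intro sum.mono_neutral_cong_left) (auto simp: b_def)
      then have "(\<integral>\<^sup>+x. ennreal (exp (s * x)) \<partial>?MX) \<le> (\<integral>\<^sup>+\<omega>. ennreal (exp (\<Sum>t\<in>T. b t * X t \<omega>)) \<partial>M)"
        unfolding eX using mult_right_mono[OF ind_le] by (intro nn_integral_mono) simp
      also have "\<dots> < \<infinity>" by (rule fin)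
      finally show "(\<integral>\<^sup>+x. ennreal (exp (s * x)) \<partial>?MX) < \<infinity>" .
    qed simp_all
    then have "(\<integral>\<^sup>+x. indicator (A u) x \<partial>?MX) = (\<integral>\<^sup>+x. indicator (A u) x \<partial>?MY)"
      by simp
    then have "(\<integral>\<^sup>+\<omega>. wX \<omega> * indicator (A u) (X u \<omega>) \<partial>M) = (\<integral>\<^sup>+\<omega>. wY \<omega> * indicator (A u) (Y u \<omega>) \<partial>N)"
      by (subst (asm) (1 2) nn_integral_distr) (simp_all add: nn_integral_density)
    moreover have "ind (insert u S) A x = ind S A x * indicator (A u) (x u)" for x
      using insert.hyps by (simp add: ind_def mult_ac)
    ultimately show ?case by (simp add: wX_def wY_def mult_ac)
  qed
  have mX': "(\<lambda>\<omega>. \<lambda>t\<in>T. X t \<omega>) \<in> M \<rightarrow>\<^sub>M Pi\<^sub>M T (\<lambda>_. borel)" by measurable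
  have mY': "(\<lambda>\<omega>. \<lambda>t\<in>T. Y t \<omega>) \<in> N \<rightarrow>\<^sub>M Pi\<^sub>M T (\<lambda>_. borel)" by measurable
  have box: "emeasure (distr M (Pi\<^sub>M T (\<lambda>_. borel)) (\<lambda>\<omega>. \<lambda>t\<in>T. X t \<omega>)) (Pi\<^sub>E T A) = (\<integral>\<^sup>+\<omega>. ind T A (\<lambda>t. X t \<omega>) \<partial>M)"
    if "\<And>t. A t \<in> sets borel" for A
  proof -
    have "ind T A (\<lambda>t. X t \<omega>) = indicator (Pi\<^sub>E T A) (\<lambda>t\<in>T. X t \<omega>)" for \<omega>
      using T by (auto simp: ind_def indicator_def prod_zero_iff Pi_iff intro!: prod.neutral)
    moreover have "Pi\<^sub>E T A \<in> sets (Pi\<^sub>M T (\<lambda>_. borel))" using T that by (intro sets_PiM_I_finite) auto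
    ultimately show ?thesis
      using nn_integral_distr[OF mX', of "indicator (Pi\<^sub>E T A)"] by simp
  qed
  have boxY: "emeasure (distr N (Pi\<^sub>M T (\<lambda>_. borel)) (\<lambda>\<omega>. \<lambda>t\<in>T. Y t \<omega>)) (Pi\<^sub>E T A) = (\<integral>\<^sup>+\<omega>. ind T A (\<lambda>t. Y t \<omega>) \<partial>N)"
    if "\<And>t. A t \<in> sets borel" for A
  proof -
    have "ind T A (\<lambda>t. Y t \<omega>) = indicator (Pi\<^sub>E T A) (\<lambda>t\<in>T. Y t \<omega>)" for \<omega>
      using T by (auto simp: ind_def indicator_def prod_zero_iff Pi_iff intro!: prod.neutral)
    moreover have "Pi\<^sub>E T A \<in> sets (Pi\<^sub>M T (\<lambda>_. borel))" using T that by (intro sets_PiM_I_finite) auto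
    ultimately show ?thesis
      using nn_integral_distr[OF mY', of "indicator (Pi\<^sub>E T A)"] by simp
  qed
  show ?thesis
  proof (rule measure_eqI_PiM_finite[OF T])
    fix A :: "'i \<Rightarrow> real set" assume A: "\<And>t. t \<in> T \<Longrightarrow> A t \<in> sets borel"
    \<comment> \<open>\<open>main\<close> asks for Borel sets at every index, so \<open>A\<close> is
      completed outside \<open>T\<close>.\<close>
    define A' where "A' t = (if t \<in> T then A t else {})" for t
    have A': "A' t \<in> sets borel" for t using A by (auto simp: A'_def)
    have "Pi\<^sub>E T A = Pi\<^sub>E T A'" by (intro PiE_cong) (auto simp: A'_def)
    with box[OF A'] boxY[OF A'] main[OF order_refl A', where a = "\<lambda>_. 0"]
    show "emeasure (distr M (Pi\<^sub>M T (\<lambda>_. borel)) (\<lambda>\<omega>. \<lambda>t\<in>T. X t \<omega>)) (Pi\<^sub>E T A)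
       = emeasure (distr N (Pi\<^sub>M T (\<lambda>_. borel)) (\<lambda>\<omega>. \<lambda>t\<in>T. Y t \<omega>)) (Pi\<^sub>E T A)" by simp
  next
    show "range (\<lambda>_::nat. Pi\<^sub>E T (\<lambda>_. UNIV :: real set)) \<subseteq> prod_algebra T (\<lambda>_. borel)"
      using T by (auto intro!: prod_algebraI_finite)
    show "(\<Union>i::nat. Pi\<^sub>E T (\<lambda>_. UNIV :: real set)) = space (Pi\<^sub>M T (\<lambda>_. borel))"
      by (simp add: space_PiM)
    show "emeasure (distr M (Pi\<^sub>M T (\<lambda>_. borel)) (\<lambda>\<omega>. \<lambda>t\<in>T. X t \<omega>)) (Pi\<^sub>E T (\<lambda>_. UNIV)) \<noteq> \<infinity>" for i::nat
      using fin[of "\<lambda>_. 0"] by (subst box) (auto simp: ind_def)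
  qed simp_all
qed

subsection \<open>Exponential tilting of Gaussian processes\<close>

text \<open>Completing the square: the factor \<open>exp x\<close> moves the mean of the normal
  density from \<open>0\<close> to \<open>\<sigma>\<^sup>2\<close> at the cost of a
  constant.\<close>

lemma normal_density_mgf:
  assumes "\<sigma> > 0"
  shows "(\<integral>\<^sup>+x. ennreal (normal_density 0 \<sigma> x) * ennreal (exp x) \<partial>lborel) = ennreal (exp (\<sigma>\<^sup>2 / 2))"
proof -
  have "normal_density 0 \<sigma> x * exp x = exp (\<sigma>\<^sup>2 / 2) * normal_density (\<sigma>\<^sup>2) \<sigma> x" for x
  proof -
    have "- (x - 0)\<^sup>2 / (2 * \<sigma>\<^sup>2) + x = \<sigma>\<^sup>2 / 2 + - (x - \<sigma>\<^sup>2)\<^sup>2 / (2 * \<sigma>\<^sup>2)"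
      using assms by (simp add: field_simps power2_eq_square)
    then show ?thesis
      unfolding normal_density_def by (simp add: exp_add[symmetric] mult_ac)
  qed
  then have "(\<integral>\<^sup>+x. ennreal (normal_density 0 \<sigma> x) * ennreal (exp x) \<partial>lborel)
    = (\<integral>\<^sup>+x. ennreal (exp (\<sigma>\<^sup>2 / 2)) * ennreal (normal_density (\<sigma>\<^sup>2) \<sigma> x) \<partial>lborel)"
    by (simp add: ennreal_mult[symmetric])
  also have "\<dots> = ennreal (exp (\<sigma>\<^sup>2 / 2)) * (\<integral>\<^sup>+x. ennreal (normal_density (\<sigma>\<^sup>2) \<sigma> x) \<partial>lborel)"
    by (rule nn_integral_cmult) simp
  also have "(\<integral>\<^sup>+x. ennreal (normal_density (\<sigma>\<^sup>2) \<sigma> x) \<partial>lborel) = 1"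
    using prob_space.emeasure_space_1[OF prob_space_normal_density[OF assms, of "\<sigma>\<^sup>2"]]
    by (simp add: emeasure_density)
  finally show ?thesis by simp
qed

context prob_space
begin

lemma gaussian_rv_integrable:
  assumes "gaussian_rv M Z"
  shows "integrable M Z" "integrable M (\<lambda>\<omega>. (Z \<omega>)\<^sup>2)"
proof -
  from assms have [measurable]: "Z \<in> borel_measurable M" by (simp add: gaussian_rv_def)
  from assms obtain \<mu> where "(AE \<omega> in M. Z \<omega> = \<mu>) \<or> (\<exists>\<sigma>>0. distributed M lborel Z (normal_density \<mu> \<sigma>))"
    unfolding gaussian_rv_def by auto
  then have "integrable M Z \<and> integrable M (\<lambda>\<omega>. (Z \<omega>)\<^sup>2)"
  proof (elim disjE exE conjE)
    assume ae: "AE \<omega> in M. Z \<omega> = \<mu>"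
    have "integrable M Z \<longleftrightarrow> integrable M (\<lambda>_. \<mu>)" using ae by (intro integrable_cong_AE) auto
    moreover have "integrable M (\<lambda>\<omega>. (Z \<omega>)\<^sup>2) \<longleftrightarrow> integrable M (\<lambda>_. \<mu>\<^sup>2)" using ae by (intro integrable_cong_AE) auto
    ultimately show ?thesis by simp
  next
    fix \<sigma> :: real assume s: "\<sigma> > 0" and d: "distributed M lborel Z (normal_density \<mu> \<sigma>)"
    have *: "integrable M (\<lambda>\<omega>. (Z \<omega> - \<mu>) ^ k)" for k
      using distributed_integrable[OF d, of "\<lambda>x. (x - \<mu>) ^ k"] integrable_normal_moment[OF s, of \<mu> k] by simp
    have "integrable M (\<lambda>\<omega>. (Z \<omega> - \<mu>) ^ 1 + \<mu>)"
      "integrable M (\<lambda>\<omega>. (Z \<omega> - \<mu>) ^ 2 + 2 * \<mu> * (Z \<omega> - \<mu>) ^ 1 + \<mu>\<^sup>2)"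
      by (intro Bochner_Integration.integrable_add integrable_mult_right * integrable_const)+
    moreover have "(\<lambda>\<omega>. (Z \<omega> - \<mu>) ^ 2 + 2 * \<mu> * (Z \<omega> - \<mu>) ^ 1 + \<mu>\<^sup>2) = (\<lambda>\<omega>. (Z \<omega>)\<^sup>2)"
      by (auto simp: fun_eq_iff power2_eq_square algebra_simps)
    ultimately show ?thesis by simp
  qed
  then show "integrable M Z" "integrable M (\<lambda>\<omega>. (Z \<omega>)\<^sup>2)" by auto
qed

text \<open>The formula uses the second moment instead of a density parameter, so that it also
  covers the degenerate case, where centring forces the constant to be \<open>0\<close>.\<close>

lemma gaussian_rv_mgf:
  assumes g: "gaussian_rv M Z" and e: "expectation Z = 0"
  shows "(\<integral>\<^sup>+\<omega>. ennreal (exp (Z \<omega>)) \<partial>M) = ennreal (exp (expectation (\<lambda>\<omega>. (Z \<omega>)\<^sup>2) / 2))"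
proof -
  from g have [measurable]: "Z \<in> borel_measurable M" by (simp add: gaussian_rv_def)
  from g obtain \<mu> where "(AE \<omega> in M. Z \<omega> = \<mu>) \<or> (\<exists>\<sigma>>0. distributed M lborel Z (normal_density \<mu> \<sigma>))"
    unfolding gaussian_rv_def by auto
  then show ?thesis
  proof (elim disjE exE conjE)
    assume ae: "AE \<omega> in M. Z \<omega> = \<mu>"
    have "expectation Z = expectation (\<lambda>_. \<mu>)" using ae by (intro integral_cong_AE) auto
    with e have "\<mu> = 0" by (simp add: prob_space)
    have "(\<integral>\<^sup>+\<omega>. ennreal (exp (Z \<omega>)) \<partial>M) = (\<integral>\<^sup>+\<omega>. 1 \<partial>M)"
      using ae \<open>\<mu> = 0\<close> by (intro nn_integral_cong_AE) auto
    moreover have "expectation (\<lambda>\<omega>. (Z \<omega>)\<^sup>2) = expectation (\<lambda>_. 0)"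
      using ae \<open>\<mu> = 0\<close> by (intro integral_cong_AE) auto
    ultimately show ?thesis by (simp add: emeasure_space_1)
  next
    fix \<sigma> :: real assume s: "\<sigma> > 0" and d: "distributed M lborel Z (normal_density \<mu> \<sigma>)"
    have "\<mu> = 0" using normal_distributed_expectation[OF s d] e by simp
    have "expectation (\<lambda>\<omega>. (Z \<omega>)\<^sup>2) = \<sigma>\<^sup>2" using normal_distributed_variance[OF s d] e by simp
    moreover have "(\<integral>\<^sup>+\<omega>. ennreal (exp (Z \<omega>)) \<partial>M)
      = (\<integral>\<^sup>+x. ennreal (normal_density 0 \<sigma> x) * ennreal (exp x) \<partial>lborel)"
      using distributed_nn_integral[OF d, of "\<lambda>x. ennreal (exp x)"] \<open>\<mu> = 0\<close> by simp
    ultimately show ?thesis by (simp add: normal_density_mgf[OF s])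
  qed
qed

lemma gaussian_process_rv:
  assumes "gaussian_process M X"
  shows "gaussian_rv M (X t)"
  using assms[unfolded gaussian_process_def, THEN conjunct2, rule_format, of "{t}" "\<lambda>_. 1"] by simp

lemma gaussian_process_measurable:
  assumes "gaussian_process M X"
  shows "X t \<in> borel_measurable M"
  using assms unfolding gaussian_process_def stoch_process_def by auto

lemma gaussian_process_mgf:
  assumes g: "gaussian_process M X" and e: "\<And>t. expectation (X t) = 0" and "finite T"
  shows "(\<integral>\<^sup>+\<omega>. ennreal (exp (\<Sum>t\<in>T. a t * X t \<omega>)) \<partial>M)
    = ennreal (exp (expectation (\<lambda>\<omega>. (\<Sum>t\<in>T. a t * X t \<omega>)\<^sup>2) / 2))"
proof (rule gaussian_rv_mgf)
  show "gaussian_rv M (\<lambda>\<omega>. \<Sum>t\<in>T. a t * X t \<omega>)"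
    using g \<open>finite T\<close> by (simp add: gaussian_process_def)
  have "expectation (\<lambda>\<omega>. \<Sum>t\<in>T. a t * X t \<omega>) = (\<Sum>t\<in>T. expectation (\<lambda>\<omega>. a t * X t \<omega>))"
    by (intro Bochner_Integration.integral_sum integrable_mult_right gaussian_rv_integrable gaussian_process_rv g)
  then show "expectation (\<lambda>\<omega>. \<Sum>t\<in>T. a t * X t \<omega>) = 0"
    using e by simp
qed

end

text \<open>Weights of total mass one make the variances cancel, which leaves only increments.\<close>

lemma sum_sq_diff_weights:
  fixes w x :: "'i \<Rightarrow> real"
  assumes "sum w S = 1"
  shows "(\<Sum>s\<in>S. \<Sum>t\<in>S. w s * w t * (x s - x t)\<^sup>2) = 2 * (\<Sum>t\<in>S. w t * (x t)\<^sup>2) - 2 * (\<Sum>t\<in>S. w t * x t)\<^sup>2"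
proof -
  have "(\<Sum>s\<in>S. \<Sum>t\<in>S. w s * w t * (x s - x t)\<^sup>2)
    = (\<Sum>s\<in>S. \<Sum>t\<in>S. (w s * (x s)\<^sup>2) * w t + w s * (w t * (x t)\<^sup>2) - 2 * ((w s * x s) * (w t * x t)))"
    by (intro sum.cong refl) (simp add: power2_eq_square algebra_simps)
  also have "\<dots> = (\<Sum>t\<in>S. w t * (x t)\<^sup>2) * sum w S + sum w S * (\<Sum>t\<in>S. w t * (x t)\<^sup>2)
      - 2 * ((\<Sum>t\<in>S. w t * x t) * (\<Sum>t\<in>S. w t * x t))"
    by (simp add: sum.distrib sum_subtractf sum_product flip: sum_distrib_left)
  finally show ?thesis using assms by (simp add: power2_eq_square)
qed

context prob_space
begin

text \<open>\<open>w\<close> absorbs the tilt: the whole exponent is the sum of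
  \<open>w t * Y t \<omega>\<close>, where \<open>t0\<close> receives the missing mass
  \<open>1 - sum a S\<close> and the weights add up to one. The halved variances in \<open>Y\<close>
  and the halved second moment from the Gaussian transform combine by
  \<open>sum_sq_diff_weights\<close>, whose factor \<open>2\<close> together with the halves gives
  the \<open>4\<close>.\<close>

lemma gaussian_tilted_mgf:
  fixes X :: "'i \<Rightarrow> 'a \<Rightarrow> real" and a :: "'i \<Rightarrow> real"
  assumes g: "gaussian_process M X" and e: "\<And>t. expectation (X t) = 0"
    and S: "finite S" "t0 \<in> S"
  defines "Y \<equiv> \<lambda>t \<omega>. X t \<omega> - variance (X t) / 2"
    and "w \<equiv> \<lambda>t. a t + (if t = t0 then 1 - sum a S else 0)"
  shows "(\<integral>\<^sup>+\<omega>. ennreal (exp (Y t0 \<omega>)) * ennreal (exp (\<Sum>t\<in>S. a t * (Y t \<omega> - Y t0 \<omega>))) \<partial>M)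
    = ennreal (exp (- (\<Sum>s\<in>S. \<Sum>t\<in>S. w s * w t * expectation (\<lambda>\<omega>. (X s \<omega> - X t \<omega>)\<^sup>2)) / 4))"
proof -
  note [measurable] = gaussian_process_measurable[OF g]
  have int2: "integrable M (\<lambda>\<omega>. (X t \<omega>)\<^sup>2)" for t
    by (intro gaussian_rv_integrable gaussian_process_rv g)
  have int_sum2: "integrable M (\<lambda>\<omega>. (\<Sum>t\<in>T. b t * X t \<omega>)\<^sup>2)" if "finite T" for T b
    using g that by (intro gaussian_rv_integrable) (simp add: gaussian_process_def)
  \<comment> \<open>A difference is a linear combination with weights \<open>1\<close> and
    \<open>-1\<close> over \<open>{s, t}\<close>; for \<open>s = t\<close> this set
    collapses.\<close>
  have int_d: "integrable M (\<lambda>\<omega>. (X s \<omega> - X t \<omega>)\<^sup>2)" for s t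
  proof (cases "s = t")
    case False
    have "(\<lambda>\<omega>. (\<Sum>u\<in>{s, t}. (if u = s then 1 else -1) * X u \<omega>)\<^sup>2) = (\<lambda>\<omega>. (X s \<omega> - X t \<omega>)\<^sup>2)"
      using False by auto
    with int_sum2[of "{s, t}" "\<lambda>u. if u = s then 1 else -1"] show ?thesis by simp
  qed simp
  have w1: "sum w S = 1"
    using S by (simp add: w_def sum.distrib)
  have wsum: "(\<Sum>t\<in>S. w t * f t) = f t0 + (\<Sum>t\<in>S. a t * (f t - f t0))" for f :: "'i \<Rightarrow> real"
  proof -
    have "(\<Sum>t\<in>S. w t * f t) = (\<Sum>t\<in>S. a t * f t) + (\<Sum>t\<in>S. if t = t0 then (1 - sum a S) * f t else 0)"
      unfolding w_def by (subst sum.distrib[symmetric]) (auto intro!: sum.cong simp: algebra_simps)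
    also have "\<dots> = (\<Sum>t\<in>S. a t * f t) + (1 - sum a S) * f t0"
      using S by simp
    finally show ?thesis by (simp add: algebra_simps sum_subtractf sum_distrib_left sum_distrib_right)
  qed
  \<comment> \<open>Centring makes variances equal to second moments, so the drifts in
    \<open>Y\<close>, weighted by \<open>w\<close>, add up to \<open>- m / 2\<close>.\<close>
  define m where "m = (\<Sum>t\<in>S. w t * expectation (\<lambda>\<omega>. (X t \<omega>)\<^sup>2))"
  have wY: "(\<Sum>t\<in>S. w t * Y t \<omega>) = (\<Sum>t\<in>S. w t * X t \<omega>) - m / 2" for \<omega>
    by (simp add: Y_def e m_def algebra_simps sum_subtractf sum_divide_distrib)
  have "(\<integral>\<^sup>+\<omega>. ennreal (exp (Y t0 \<omega>)) * ennreal (exp (\<Sum>t\<in>S. a t * (Y t \<omega> - Y t0 \<omega>))) \<partial>M)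
    = (\<integral>\<^sup>+\<omega>. ennreal (exp (- m / 2)) * ennreal (exp (\<Sum>t\<in>S. w t * X t \<omega>)) \<partial>M)"
  proof (intro nn_integral_cong)
    fix \<omega>
    have "Y t0 \<omega> + (\<Sum>t\<in>S. a t * (Y t \<omega> - Y t0 \<omega>)) = - m / 2 + (\<Sum>t\<in>S. w t * X t \<omega>)"
      using wsum[of "\<lambda>t. Y t \<omega>"] wY[of \<omega>] by simp
    then show "ennreal (exp (Y t0 \<omega>)) * ennreal (exp (\<Sum>t\<in>S. a t * (Y t \<omega> - Y t0 \<omega>)))
      = ennreal (exp (- m / 2)) * ennreal (exp (\<Sum>t\<in>S. w t * X t \<omega>))"
      by (simp only: ennreal_mult[symmetric] exp_ge_zero exp_add[symmetric])
  qed
  also have "\<dots> = ennreal (exp (- m / 2)) * ennreal (exp (expectation (\<lambda>\<omega>. (\<Sum>t\<in>S. w t * X t \<omega>)\<^sup>2) / 2))"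
    using gaussian_process_mgf[OF g e S(1), of w] by (subst nn_integral_cmult) auto
  also have "\<dots> = ennreal (exp (- (2 * m - 2 * expectation (\<lambda>\<omega>. (\<Sum>t\<in>S. w t * X t \<omega>)\<^sup>2)) / 4))"
    by (simp add: ennreal_mult[symmetric] exp_add[symmetric] field_simps)
  \<comment> \<open>The identity for weights of sum one is now applied pointwise under the
    expectation.\<close>
  also have "2 * m - 2 * expectation (\<lambda>\<omega>. (\<Sum>t\<in>S. w t * X t \<omega>)\<^sup>2)
     = expectation (\<lambda>\<omega>. 2 * (\<Sum>t\<in>S. w t * (X t \<omega>)\<^sup>2) - 2 * (\<Sum>t\<in>S. w t * X t \<omega>)\<^sup>2)"
    unfolding m_def using S(1)
    by (subst Bochner_Integration.integral_diff) (auto simp: Bochner_Integration.integral_sum int2 int_sum2)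
  also have "\<dots> = expectation (\<lambda>\<omega>. \<Sum>s\<in>S. \<Sum>t\<in>S. w s * w t * (X s \<omega> - X t \<omega>)\<^sup>2)"
    by (simp only: sum_sq_diff_weights[OF w1])
  also have "\<dots> = (\<Sum>s\<in>S. \<Sum>t\<in>S. w s * w t * expectation (\<lambda>\<omega>. (X s \<omega> - X t \<omega>)\<^sup>2))"
    by (simp add: Bochner_Integration.integral_sum int_d)
  finally show ?thesis .
qed

end

text \<open>Two processes on unrelated spaces are compared because this serves twice: for a process
  and its shift, which yields stationarity, and for two processes with a common variogram. With
  \<open>exp (Y t0)\<close> as a density, the rest of the integrand is a function of the differences
  to \<open>t0\<close>.\<close>

lemma gaussian_sup_exp_eq:
  fixes X :: "'i \<Rightarrow> 'a \<Rightarrow> real" and X' :: "'i \<Rightarrow> 'b \<Rightarrow> real"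
  assumes g: "gaussian_process M X" "\<And>t. integral\<^sup>L M (X t) = 0"
    and g': "gaussian_process N X'" "\<And>t. integral\<^sup>L N (X' t) = 0"
    and S: "finite S"
    and eq: "\<And>s t. integral\<^sup>L M (\<lambda>\<omega>. (X s \<omega> - X t \<omega>)\<^sup>2) = integral\<^sup>L N (\<lambda>\<omega>. (X' s \<omega> - X' t \<omega>)\<^sup>2)"
  shows "(\<integral>\<^sup>+\<omega>. (SUP t\<in>S. ennreal (exp (X t \<omega> - prob_space.variance M (X t) / 2 - y t))) \<partial>M)
       = (\<integral>\<^sup>+\<omega>. (SUP t\<in>S. ennreal (exp (X' t \<omega> - prob_space.variance N (X' t) / 2 - y t))) \<partial>N)"
proof (cases "S = {}")
  case False
  then obtain t0 where t0: "t0 \<in> S" by auto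
  interpret M: prob_space M using g(1) by (simp add: gaussian_process_def stoch_process_def)
  interpret N: prob_space N using g'(1) by (simp add: gaussian_process_def stoch_process_def)
  note [measurable] = M.gaussian_process_measurable[OF g(1)] N.gaussian_process_measurable[OF g'(1)]
  define Y where "Y = (\<lambda>t \<omega>. X t \<omega> - M.variance (X t) / 2)"
  define Y' where "Y' = (\<lambda>t \<omega>. X' t \<omega> - N.variance (X' t) / 2)"
  have [measurable]: "Y t \<in> borel_measurable M" "Y' t \<in> borel_measurable N" for t
    unfolding Y_def Y'_def by measurable
  let ?P = "Pi\<^sub>M S (\<lambda>_. borel :: real measure)"
  let ?Q = "density M (\<lambda>\<omega>. ennreal (exp (Y t0 \<omega>)))" and ?Q' = "density N (\<lambda>\<omega>. ennreal (exp (Y' t0 \<omega>)))"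
  have law: "distr ?Q ?P (\<lambda>\<omega>. \<lambda>t\<in>S. Y t \<omega> - Y t0 \<omega>) = distr ?Q' ?P (\<lambda>\<omega>. \<lambda>t\<in>S. Y' t \<omega> - Y' t0 \<omega>)"
  proof (rule distr_PiM_eqI_mgf[OF S])
    fix a
    show "(\<integral>\<^sup>+\<omega>. ennreal (exp (\<Sum>t\<in>S. a t * (Y t \<omega> - Y t0 \<omega>))) \<partial>?Q)
      = (\<integral>\<^sup>+\<omega>. ennreal (exp (\<Sum>t\<in>S. a t * (Y' t \<omega> - Y' t0 \<omega>))) \<partial>?Q')"
      using M.gaussian_tilted_mgf[OF g S t0, of a] N.gaussian_tilted_mgf[OF g' S t0, of a]
      by (simp add: nn_integral_density Y_def Y'_def eq)
    show "(\<integral>\<^sup>+\<omega>. ennreal (exp (\<Sum>t\<in>S. a t * (Y t \<omega> - Y t0 \<omega>))) \<partial>?Q) < \<infinity>"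
      using M.gaussian_tilted_mgf[OF g S t0, of a]
      by (simp add: nn_integral_density Y_def)
  qed measurable
  define h where "h z = (SUP t\<in>S. ennreal (exp (z t - y t)))" for z :: "'i \<Rightarrow> real"
  have [measurable]: "h \<in> borel_measurable ?P"
    unfolding h_def by (intro borel_measurable_SUP countable_finite S) measurable
  have *: "(SUP t\<in>S. ennreal (exp (u t - y t))) = ennreal (exp (u t0)) * h (\<lambda>t\<in>S. u t - u t0)" for u
    unfolding h_def by (subst SUP_mult_left_ennreal)
      (auto intro!: SUP_cong simp: ennreal_mult[symmetric] exp_add[symmetric])
  have "(\<integral>\<^sup>+\<omega>. (SUP t\<in>S. ennreal (exp (Y t \<omega> - y t))) \<partial>M) = (\<integral>\<^sup>+z. h z \<partial>distr ?Q ?P (\<lambda>\<omega>. \<lambda>t\<in>S. Y t \<omega> - Y t0 \<omega>))"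
    by (subst nn_integral_distr, measurable) (simp add: nn_integral_density *)
  also have "\<dots> = (\<integral>\<^sup>+\<omega>. (SUP t\<in>S. ennreal (exp (Y' t \<omega> - y t))) \<partial>N)"
    unfolding law by (subst nn_integral_distr, measurable) (simp add: nn_integral_density *)
  finally show ?thesis by (simp add: Y_def Y'_def)
qed (simp add: bot_ennreal)

subsection \<open>Laplace functional of a Poisson process\<close>

lemma point_count_eq_emeasure: "point_count U B \<omega> = emeasure (count_space UNIV) {i. U i \<omega> \<in> B}"
proof -
  have "point_count U B \<omega> = (\<integral>\<^sup>+i. indicator B (U i \<omega>) \<partial>count_space UNIV)"
    by (simp add: point_count_def nn_integral_count_space_nat)
  also have "\<dots> = (\<integral>\<^sup>+i. indicator {i. U i \<omega> \<in> B} i \<partial>count_space UNIV)"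
    by (intro nn_integral_cong) (simp add: indicator_def)
  finally show ?thesis by simp
qed

lemma point_count_measurable:
  assumes "stoch_process M U" "B \<in> sets borel"
  shows "point_count U B \<in> borel_measurable M"
proof -
  have [measurable]: "U i \<in> borel_measurable M" for i using assms by (simp add: stoch_process_def)
  note [measurable] = assms(2)
  show ?thesis unfolding point_count_def by measurable
qed

text \<open>This is \<open>c ^ n\<close> at \<open>x = of_nat n\<close>; at \<open>x = \<infinity>\<close>, a null event below, it is \<open>0\<close> for every \<open>c\<close>.\<close>

definition count_pow :: "real \<Rightarrow> ennreal \<Rightarrow> ennreal" where
  "count_pow c x = (\<Sum>k. ennreal (c ^ k) * indicator {of_nat k} x)"

lemma count_pow_measurable [measurable]: "count_pow c \<in> borel_measurable borel"
  unfolding count_pow_def by measurable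

lemma count_pow_of_nat: "count_pow c (of_nat m) = ennreal (c ^ m)"
proof -
  have "count_pow c (of_nat m) = (\<Sum>k\<in>{m}. ennreal (c ^ k) * indicator {of_nat k} (of_nat m :: ennreal))"
    unfolding count_pow_def by (intro suminf_finite) auto
  then show ?thesis by simp
qed

locale poisson_points = prob_space M for M :: "'a measure" +
  fixes U :: "nat \<Rightarrow> 'a \<Rightarrow> real" and \<Lambda> :: "real measure"
  assumes sets_intensity [measurable_cong]: "sets \<Lambda> = sets borel"
    and poisson: "poisson_point_process M U \<Lambda>"
begin

lemma points_measurable [measurable]: "U i \<in> borel_measurable M"
  using poisson by (simp add: poisson_point_process_def stoch_process_def)

lemma count_measurable [measurable]: "B \<in> sets borel \<Longrightarrow> point_count U B \<in> borel_measurable M"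
  using point_count_measurable poisson by (auto simp: poisson_point_process_def)

lemma prob_count:
  assumes "B \<in> sets borel" "emeasure \<Lambda> B < \<infinity>"
  shows "prob {\<omega> \<in> space M. point_count U B \<omega> = of_nat k} = exp (- measure \<Lambda> B) * measure \<Lambda> B ^ k / fact k"
  using poisson assms by (simp add: poisson_point_process_def)

text \<open>This is the probability generating function of a Poisson variable at \<open>c\<close>.
  At \<open>c = 1\<close> it will show that the count is almost surely finite; at one minus a value
  of a step function it gives the contribution of that level set to the Laplace functional.\<close>

lemma prob_count_sums:
  assumes "B \<in> sets borel" "emeasure \<Lambda> B < \<infinity>"
  shows "(\<lambda>k. c ^ k * prob {\<omega> \<in> space M. point_count U B \<omega> = of_nat k}) sums exp (- ((1 - c) * measure \<Lambda> B))"
proof -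
  have "(\<lambda>k. exp (- measure \<Lambda> B) * ((c * measure \<Lambda> B) ^ k /\<^sub>R fact k)) sums (exp (- measure \<Lambda> B) * exp (c * measure \<Lambda> B))"
    by (intro sums_mult exp_converges)
  moreover have "exp (- measure \<Lambda> B) * exp (c * measure \<Lambda> B) = exp (- ((1 - c) * measure \<Lambda> B))"
    by (simp add: exp_add[symmetric] algebra_simps)
  ultimately show ?thesis
    by (simp add: prob_count[OF assms] field_simps)
qed

text \<open>The finite values of the count already carry total probability one.\<close>

lemma AE_finite_count:
  assumes B: "B \<in> sets borel" "emeasure \<Lambda> B < \<infinity>"
  shows "AE \<omega> in M. finite {i. U i \<omega> \<in> B}"
proof -
  note [measurable] = B(1)
  define A where "A k = {\<omega> \<in> space M. point_count U B \<omega> = of_nat k}" for k :: nat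
  have [measurable]: "A k \<in> events" for k unfolding A_def by measurable
  have "(\<lambda>k. prob (A k)) sums prob (\<Union>k. A k)"
    by (intro finite_measure_UNION) (auto simp: disjoint_family_on_def A_def)
  moreover have "(\<lambda>k. prob (A k)) sums 1"
    using prob_count_sums[OF B, of 1] by (simp add: A_def)
  ultimately have "prob (\<Union>k. A k) = 1" by (rule sums_unique2)
  then have "AE \<omega> in M. \<omega> \<in> (\<Union>k. A k)" by (subst (asm) prob_eq_1) auto
  then show ?thesis
  proof eventually_elim
    case (elim \<omega>)
    then show ?case
      by (auto simp: A_def point_count_eq_emeasure emeasure_count_space split: if_splits)
  qed
qed

lemma nn_integral_count_pow:
  assumes B: "B \<in> sets borel" "emeasure \<Lambda> B < \<infinity>" and c: "0 \<le> c"
  shows "(\<integral>\<^sup>+\<omega>. count_pow c (point_count U B \<omega>) \<partial>M) = ennreal (exp (- ((1 - c) * measure \<Lambda> B)))"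
proof -
  note [measurable] = B(1)
  have "(\<integral>\<^sup>+\<omega>. count_pow c (point_count U B \<omega>) \<partial>M)
    = (\<Sum>k. \<integral>\<^sup>+\<omega>. ennreal (c ^ k) * indicator {of_nat k} (point_count U B \<omega>) \<partial>M)"
    unfolding count_pow_def by (intro nn_integral_suminf) measurable
  also have "\<dots> = (\<Sum>k. ennreal (c ^ k * prob {\<omega> \<in> space M. point_count U B \<omega> = of_nat k}))"
  proof (intro suminf_cong)
    fix k :: nat
    have "(\<integral>\<^sup>+\<omega>. ennreal (c ^ k) * indicator {of_nat k} (point_count U B \<omega>) \<partial>M)
      = (\<integral>\<^sup>+\<omega>. ennreal (c ^ k) * indicator {\<omega> \<in> space M. point_count U B \<omega> = of_nat k} \<omega> \<partial>M)"
      by (intro nn_integral_cong) (simp add: indicator_def)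
    also have "\<dots> = ennreal (c ^ k) * emeasure M {\<omega> \<in> space M. point_count U B \<omega> = of_nat k}"
      by (intro nn_integral_cmult_indicator) measurable
    finally show "(\<integral>\<^sup>+\<omega>. ennreal (c ^ k) * indicator {of_nat k} (point_count U B \<omega>) \<partial>M)
      = ennreal (c ^ k * prob {\<omega> \<in> space M. point_count U B \<omega> = of_nat k})"
      using c by (simp add: emeasure_eq_measure ennreal_mult)
  qed
  also have "\<dots> = ennreal (exp (- ((1 - c) * measure \<Lambda> B)))"
    using c by (intro suminf_ennreal_eq prob_count_sums B) auto
  finally show ?thesis .
qed

text \<open>The level sets of \<open>s\<close> are disjoint, so their counts are independent Poisson
  variables. The product over all points becomes the product over the values \<open>c\<close> of
  \<open>1 - c\<close> raised to the count of the level set, and its expectation factors into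
  generating functions.\<close>

lemma laplace_step:
  fixes s :: "real \<Rightarrow> real"
  assumes s[measurable]: "s \<in> borel_measurable borel" and fin: "finite (range s)"
    and s01: "\<And>x. 0 \<le> s x" "\<And>x. s x \<le> 1" and int: "(\<integral>\<^sup>+x. ennreal (s x) \<partial>\<Lambda>) < \<infinity>"
  shows "(\<lambda>k. \<integral>\<^sup>+\<omega>. ennreal (\<Prod>i<k. 1 - s (U i \<omega>)) \<partial>M)
    \<longlonglongrightarrow> ennreal (exp (- enn2real (\<integral>\<^sup>+x. ennreal (s x) \<partial>\<Lambda>)))"
proof -
  \<comment> \<open>The value \<open>0\<close> is left out: its level set may have infinite
    intensity, and its points contribute the factor \<open>1\<close>.\<close>
  define C where "C = range s - {0}"
  define B where "B c = s -` {c}" for c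
  have C: "finite C" "\<And>c. c \<in> C \<Longrightarrow> 0 < c" "\<And>c. c \<in> C \<Longrightarrow> c \<le> 1"
    using fin s01 by (auto simp: C_def less_le)
  have B[measurable]: "B c \<in> sets borel" for c
    using measurable_sets[OF s, of "{c}"] by (simp add: B_def)
  have s_eq: "ennreal (s x) = (\<Sum>c\<in>C. ennreal c * indicator (B c) x)" for x
  proof (cases "s x = 0")
    case True
    then show ?thesis by (auto simp: C_def B_def indicator_def intro!: sum.neutral)
  next
    case False
    then have "s x \<in> C" by (simp add: C_def)
    have "(\<Sum>c\<in>C. ennreal c * indicator (B c) x) = (\<Sum>c\<in>C. if c = s x then ennreal c else 0)"
      by (intro sum.cong) (auto simp: B_def indicator_def)
    then show ?thesis using C \<open>s x \<in> C\<close> by simp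
  qed
  have int_s: "(\<integral>\<^sup>+x. ennreal (s x) \<partial>\<Lambda>) = (\<Sum>c\<in>C. ennreal c * emeasure \<Lambda> (B c))"
    unfolding s_eq by (subst nn_integral_sum) (auto simp: nn_integral_cmult_indicator sets_intensity)
  have finB: "emeasure \<Lambda> (B c) < \<infinity>" if "c \<in> C" for c
  proof -
    have "ennreal c * emeasure \<Lambda> (B c) < \<infinity>"
      using int C(1) that unfolding int_s by (simp add: less_top)
    then show ?thesis using C(2)[OF that] by (auto simp: ennreal_mult_less_top)
  qed
  have int_s': "(\<integral>\<^sup>+x. ennreal (s x) \<partial>\<Lambda>) = ennreal (\<Sum>c\<in>C. c * measure \<Lambda> (B c))"
  proof -
    have "ennreal c * emeasure \<Lambda> (B c) = ennreal (c * measure \<Lambda> (B c))" if "c \<in> C" for c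
      using finB[OF that] C(2)[OF that] by (simp add: emeasure_eq_ennreal_measure ennreal_mult less_top)
    then have "(\<integral>\<^sup>+x. ennreal (s x) \<partial>\<Lambda>) = (\<Sum>c\<in>C. ennreal (c * measure \<Lambda> (B c)))"
      unfolding int_s by (intro sum.cong) auto
    then show ?thesis using C by (simp add: sum_ennreal less_imp_le)
  qed
  define n where "n = card C"
  \<comment> \<open>Independence of counts is given for families indexed by \<open>{..<n}\<close>,
    hence the enumeration of the values.\<close>
  obtain e where e: "bij_betw e {..<n} C"
    using ex_bij_betw_nat_finite[OF C(1)] by (auto simp: n_def atLeast0LessThan)
  then have eC: "e j \<in> C" if "j < n" for j using that by (auto simp: bij_betw_def)
  let ?L = "\<lambda>\<omega>. \<Prod>c\<in>C. count_pow (1 - c) (point_count U (B c) \<omega>)"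
  have "disjoint_family_on (\<lambda>j. B (e j)) {..<n}"
    using e by (auto simp: disjoint_family_on_def B_def bij_betw_def inj_on_def)
  then have "indep_vars (\<lambda>_. borel) (\<lambda>j. point_count U (B (e j))) {..<n}"
    using poisson B by (auto simp: poisson_point_process_def)
  then have ind: "indep_vars (\<lambda>_. borel) (\<lambda>j \<omega>. count_pow (1 - e j) (point_count U (B (e j)) \<omega>)) {..<n}"
    by (rule indep_vars_compose2) measurable
  have "(\<integral>\<^sup>+\<omega>. ?L \<omega> \<partial>M) = (\<integral>\<^sup>+\<omega>. (\<Prod>j<n. count_pow (1 - e j) (point_count U (B (e j)) \<omega>)) \<partial>M)"
    by (subst prod.reindex_bij_betw[OF e]) simp
  also have "\<dots> = (\<Prod>j<n. \<integral>\<^sup>+\<omega>. count_pow (1 - e j) (point_count U (B (e j)) \<omega>) \<partial>M)"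
    by (intro indep_vars_nn_integral ind) auto
  also have "\<dots> = (\<Prod>j<n. ennreal (exp (- (e j * measure \<Lambda> (B (e j))))))"
    using eC C(3) finB by (intro prod.cong refl) (subst nn_integral_count_pow; auto)
  also have "\<dots> = (\<Prod>c\<in>C. ennreal (exp (- (c * measure \<Lambda> (B c)))))"
    by (subst prod.reindex_bij_betw[OF e]) simp
  also have "\<dots> = ennreal (exp (- enn2real (\<integral>\<^sup>+x. ennreal (s x) \<partial>\<Lambda>)))"
    unfolding int_s' using C by (simp add: prod_ennreal exp_sum sum_negf[symmetric] sum_nonneg less_imp_le)
  finally have L: "(\<integral>\<^sup>+\<omega>. ?L \<omega> \<partial>M) = ennreal (exp (- enn2real (\<integral>\<^sup>+x. ennreal (s x) \<partial>\<Lambda>)))" .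
  have "(\<lambda>k. \<integral>\<^sup>+\<omega>. ennreal (\<Prod>i<k. 1 - s (U i \<omega>)) \<partial>M) \<longlonglongrightarrow> (\<integral>\<^sup>+\<omega>. ?L \<omega> \<partial>M)"
  proof (rule nn_integral_dominated_convergence[where w = "\<lambda>_. 1"])
    show "AE \<omega> in M. ennreal (\<Prod>i<k. 1 - s (U i \<omega>)) \<le> 1" for k
      using s01 by (intro AE_I2) (simp add: prod_le_1)
    have "AE \<omega> in M. \<forall>c\<in>C. finite {i. U i \<omega> \<in> B c}"
      using C(1) finB by (subst AE_finite_all) (auto intro: AE_finite_count)
    then show "AE \<omega> in M. (\<lambda>k. ennreal (\<Prod>i<k. 1 - s (U i \<omega>))) \<longlonglongrightarrow> ?L \<omega>"
    proof eventually_elim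
      case (elim \<omega>)
      \<comment> \<open>Almost surely only finitely many points meet a nonzero value, so the partial
        products are eventually constant; sorting the factors by value gives the powers.\<close>
      define F where "F = {i. s (U i \<omega>) \<noteq> 0}"
      have "F = (\<Union>c\<in>C. {i. U i \<omega> \<in> B c})" by (auto simp: F_def C_def B_def)
      with elim C have F: "finite F" by auto
      have "(\<Prod>i\<in>F. 1 - s (U i \<omega>)) = (\<Prod>c\<in>C. \<Prod>i\<in>{i\<in>F. s (U i \<omega>) = c}. 1 - s (U i \<omega>))"
        using F C(1) by (intro prod.group[symmetric]) (auto simp: F_def C_def)
      also have "\<dots> = (\<Prod>c\<in>C. (1 - c) ^ card {i. U i \<omega> \<in> B c})"
      proof (intro prod.cong refl)
        fix c assume "c \<in> C"
        then have "{i\<in>F. s (U i \<omega>) = c} = {i. U i \<omega> \<in> B c}"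
          by (auto simp: F_def C_def B_def)
        moreover have "(\<Prod>i\<in>{i. U i \<omega> \<in> B c}. 1 - s (U i \<omega>)) = (\<Prod>i\<in>{i. U i \<omega> \<in> B c}. 1 - c)"
          by (intro prod.cong) (auto simp: B_def)
        ultimately show "(\<Prod>i\<in>{i\<in>F. s (U i \<omega>) = c}. 1 - s (U i \<omega>)) = (1 - c) ^ card {i. U i \<omega> \<in> B c}"
          by simp
      qed
      finally have "ennreal (\<Prod>i\<in>F. 1 - s (U i \<omega>)) = (\<Prod>c\<in>C. ennreal ((1 - c) ^ card {i. U i \<omega> \<in> B c}))"
        using C(3) by (simp add: prod_ennreal)
      also have "\<dots> = ?L \<omega>"
        using elim by (intro prod.cong refl)
          (simp add: point_count_eq_emeasure count_pow_of_nat)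
      finally have FL: "ennreal (\<Prod>i\<in>F. 1 - s (U i \<omega>)) = ?L \<omega>" .
      obtain K where K: "F \<subseteq> {..<K}" using F finite_nat_iff_bounded by auto
      have "\<forall>\<^sub>F k in sequentially. ennreal (\<Prod>i<k. 1 - s (U i \<omega>)) = ?L \<omega>"
        using eventually_ge_at_top[of K]
      proof eventually_elim
        case (elim k)
        have "(\<Prod>i<k. 1 - s (U i \<omega>)) = (\<Prod>i\<in>F. 1 - s (U i \<omega>))"
          using K elim by (intro prod.mono_neutral_right) (auto simp: F_def)
        with FL show ?case by simp
      qed
      then show ?case by (rule tendsto_eventually)
    qed
  qed (use C in \<open>auto simp: emeasure_space_1 intro!: borel_measurable_prod_ennreal\<close>)
  then show ?thesis by (simp only: L)
qed

text \<open>\<open>h\<close> is approached from below by step functions \<open>s n\<close>. The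
  expected products \<open>q n k\<close> decrease both in \<open>n\<close> and in \<open>k\<close>,
  so both limits are infima and may be exchanged.\<close>

lemma laplace_functional:
  fixes h :: "real \<Rightarrow> real"
  assumes h[measurable]: "h \<in> borel_measurable borel"
    and h01: "\<And>x. 0 \<le> h x" "\<And>x. h x \<le> 1" and int: "(\<integral>\<^sup>+x. ennreal (h x) \<partial>\<Lambda>) < \<infinity>"
  shows "(\<lambda>k. \<integral>\<^sup>+\<omega>. ennreal (\<Prod>i<k. 1 - h (U i \<omega>)) \<partial>M)
    \<longlonglongrightarrow> ennreal (exp (- enn2real (\<integral>\<^sup>+x. ennreal (h x) \<partial>\<Lambda>)))"
proof -
  obtain f :: "nat \<Rightarrow> real \<Rightarrow> ennreal" where f: "\<And>n. simple_function borel (f n)" "incseq f"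
      "\<And>n x. f n x < top" "\<And>x. (SUP n. f n x) = ennreal (h x)"
    using borel_measurable_implies_simple_function_sequence'[of "\<lambda>x. ennreal (h x)" borel] by auto
  define s where "s n x = enn2real (f n x)" for n x
  have fs: "f n x = ennreal (s n x)" for n x using f(3)[of n x] by (simp add: s_def)
  have [measurable]: "f n \<in> borel_measurable borel" for n using f(1) by (rule borel_measurable_simple_function)
  have [measurable]: "s n \<in> borel_measurable borel" for n unfolding s_def by measurable
  have fle: "f n x \<le> ennreal (h x)" for n x unfolding f(4)[symmetric] by (intro SUP_upper) auto
  have sle: "0 \<le> s n x" "s n x \<le> h x" for n x
    using fle[of n x] h01[of x] unfolding fs by (auto simp: s_def)
  have sle1: "s n x \<le> 1" for n x using sle(2)[of n x] h01(2)[of x] by simp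
  have finr: "finite (range (s n))" for n
    using f(1)[of n] unfolding simple_function_def s_def by (auto simp: image_comp[symmetric, unfolded comp_def])
  have smono: "s m x \<le> s n x" if "m \<le> n" for m n x
    using incseqD[OF f(2) that] sle(1) unfolding le_fun_def fs by auto
  have flim: "(\<lambda>n. f n x) \<longlonglongrightarrow> ennreal (h x)" for x
    using LIMSEQ_SUP[of "\<lambda>n. f n x"] f(2,4) by (auto simp: incseq_def le_fun_def)
  have slim: "(\<lambda>n. s n x) \<longlonglongrightarrow> h x" for x
    using flim[of x] h01 sle unfolding fs by simp
  define I where "I g = enn2real (\<integral>\<^sup>+x. ennreal (g x) \<partial>\<Lambda>)" for g
  have sint: "(\<integral>\<^sup>+x. ennreal (s n x) \<partial>\<Lambda>) \<le> (\<integral>\<^sup>+x. ennreal (h x) \<partial>\<Lambda>)" for n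
    using sle by (intro nn_integral_mono) (auto intro: ennreal_leI)
  have Imono: "I (s m) \<le> I (s n)" if "m \<le> n" for m n
    unfolding I_def using smono[OF that] sint[of n] int
    by (intro enn2real_mono nn_integral_mono) (auto intro: ennreal_leI)
  have Ilim: "(\<lambda>n. I (s n)) \<longlonglongrightarrow> I h"
  proof -
    have "(\<lambda>n. \<integral>\<^sup>+x. f n x \<partial>\<Lambda>) \<longlonglongrightarrow> (\<integral>\<^sup>+x. ennreal (h x) \<partial>\<Lambda>)"
      by (intro nn_integral_LIMSEQ f(2) flim) measurable
    then show ?thesis unfolding I_def fs using int by (intro tendsto_enn2real) auto
  qed
  define q where "q n k = (\<integral>\<^sup>+\<omega>. ennreal (\<Prod>i<k. 1 - s n (U i \<omega>)) \<partial>M)" for n k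
  define q' where "q' k = (\<integral>\<^sup>+\<omega>. ennreal (\<Prod>i<k. 1 - h (U i \<omega>)) \<partial>M)" for k
  have dec_prod: "(\<Prod>i<l. 1 - g (U i \<omega>)) \<le> (\<Prod>i<k. 1 - g (U i \<omega>))"
    if "k \<le> l" "\<And>x. 0 \<le> g x" "\<And>x. g x \<le> 1" for k l \<omega> and g :: "real \<Rightarrow> real"
  proof -
    have "(\<Prod>i<l. 1 - g (U i \<omega>)) = (\<Prod>i<k. 1 - g (U i \<omega>)) * (\<Prod>i\<in>{k..<l}. 1 - g (U i \<omega>))"
      using prod.atLeastLessThan_concat[of 0 k l "\<lambda>i. 1 - g (U i \<omega>)"] that by (simp add: atLeast0LessThan)
    also have "\<dots> \<le> (\<Prod>i<k. 1 - g (U i \<omega>)) * 1"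
      using that by (intro mult_left_mono prod_le_1 prod_nonneg) auto
    finally show ?thesis by simp
  qed
  have "(INF k. q n k) = ennreal (exp (- I (s n)))" for n
  proof (rule LIMSEQ_unique)
    show "q n \<longlonglongrightarrow> (INF k. q n k)"
      unfolding q_def by (intro LIMSEQ_INF decseq_SucI nn_integral_mono ennreal_leI dec_prod) (auto simp: sle sle1)
    show "q n \<longlonglongrightarrow> ennreal (exp (- I (s n)))"
      unfolding q_def I_def using sint[of n] int by (intro laplace_step finr sle sle1) auto
  qed
  moreover have "(INF n. q n k) = q' k" for k
  proof (rule LIMSEQ_unique)
    show "(\<lambda>n. q n k) \<longlonglongrightarrow> (INF n. q n k)"
      unfolding q_def
      by (intro LIMSEQ_INF decseq_SucI nn_integral_mono ennreal_leI prod_mono) (auto simp: sle sle1 smono)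
    show "(\<lambda>n. q n k) \<longlonglongrightarrow> q' k"
      unfolding q_def q'_def
    proof (rule nn_integral_dominated_convergence[where w = "\<lambda>_. 1"])
      show "AE \<omega> in M. ennreal (\<Prod>i<k. 1 - s n (U i \<omega>)) \<le> 1" for n
        using sle sle1 by (intro AE_I2) (simp add: prod_le_1)
      show "AE \<omega> in M. (\<lambda>n. ennreal (\<Prod>i<k. 1 - s n (U i \<omega>))) \<longlonglongrightarrow> ennreal (\<Prod>i<k. 1 - h (U i \<omega>))"
        by (intro AE_I2 tendsto_ennrealI tendsto_prod tendsto_diff tendsto_const slim)
    qed (auto simp: emeasure_space_1)
  qed
  moreover have "(INF n. ennreal (exp (- I (s n)))) = ennreal (exp (- I h))"
  proof (rule LIMSEQ_unique)
    show "(\<lambda>n. ennreal (exp (- I (s n)))) \<longlonglongrightarrow> (INF n. ennreal (exp (- I (s n))))"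
      by (intro LIMSEQ_INF decseq_SucI ennreal_leI) (simp add: Imono)
    show "(\<lambda>n. ennreal (exp (- I (s n)))) \<longlonglongrightarrow> ennreal (exp (- I h))"
      by (intro tendsto_ennrealI tendsto_exp tendsto_minus Ilim)
  qed
  ultimately have "(INF k. q' k) = ennreal (exp (- I h))"
    using INF_commute[of "\<lambda>k n. q n k" UNIV UNIV] by simp
  moreover have "q' \<longlonglongrightarrow> (INF k. q' k)"
    unfolding q'_def by (intro LIMSEQ_INF decseq_SucI nn_integral_mono ennreal_leI dec_prod) (auto simp: h01)
  ultimately show ?thesis unfolding q'_def I_def by simp
qed

end

subsection \<open>Marked points and finite-dimensional distribution functions\<close>

lemma emeasure_exp_intensity_greaterThan: "emeasure exp_intensity {a<..} = ennreal (exp (- a))"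
proof -
  have "emeasure exp_intensity {a<..} = (\<integral>\<^sup>+x. ennreal (exp (- x)) * indicator {a<..} x \<partial>lborel)"
    unfolding exp_intensity_def by (subst emeasure_density) auto
  also have "\<dots> = (\<integral>\<^sup>+x. ennreal (exp (- x)) * indicator {a..} x \<partial>lborel)"
    using AE_lborel_singleton[of a] by (intro nn_integral_cong_AE) (auto elim!: eventually_mono simp: indicator_def)
  also have "\<dots> = ennreal (0 - (- exp (- a)))"
  proof (rule nn_integral_FTC_atLeast)
    show "((\<lambda>x. - exp (- x)) \<longlongrightarrow> (0::real)) at_top"
      using tendsto_minus[OF filterlim_compose[OF exp_at_bot filterlim_uminus_at_bot_at_top]] by simp
  qed (auto intro!: derivative_eq_intros)
  finally show ?thesis by simp
qed

text \<open>A nonempty finite union of right half lines is the one starting at the lowest threshold.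
  This is the origin of the maximum of exponentials: it is the intensity of the heights that break
  at least one bound.\<close>

lemma emeasure_exp_intensity_UN_greaterThan:
  assumes "finite S"
  shows "emeasure exp_intensity {u. \<exists>t\<in>S. u > x t} = (SUP t\<in>S. ennreal (exp (- x t)))"
proof (cases "S = {}")
  case False
  then obtain t0 where t0: "t0 \<in> S" "\<And>t. t \<in> S \<Longrightarrow> x t0 \<le> x t"
    using assms by (metis arg_min_if_finite(1) arg_min_least)
  then have "{u. \<exists>t\<in>S. u > x t} = {x t0<..}" by force
  moreover have "(SUP t\<in>S. ennreal (exp (- x t))) = ennreal (exp (- x t0))"
    using t0 by (intro antisym SUP_least SUP_upper) (auto intro!: ennreal_leI)
  ultimately show ?thesis by (simp add: emeasure_exp_intensity_greaterThan)
qed (simp add: bot_ennreal)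

text \<open>Under the product law the points can be frozen and the marks integrated first. These are
  independent with common law \<open>\<nu>\<close>, so the condition on the first \<open>k\<close>
  points becomes a product.\<close>

lemma (in prob_space) prob_marked_points:
  fixes U :: "nat \<Rightarrow> 'a \<Rightarrow> real" and \<xi> :: "nat \<Rightarrow> 'a \<Rightarrow> 'n"
  assumes \<xi>: "indep_vars (\<lambda>_. N) \<xi> UNIV" and law: "\<And>i. distr M N (\<xi> i) = \<nu>"
    and U[measurable]: "(\<lambda>\<omega> i. U i \<omega>) \<in> M \<rightarrow>\<^sub>M Pi\<^sub>M UNIV (\<lambda>_. borel)"
    and joint_distr: "distr M (Pi\<^sub>M UNIV (\<lambda>_. borel) \<Otimes>\<^sub>M Pi\<^sub>M UNIV (\<lambda>_. N)) (\<lambda>\<omega>. (\<lambda>i. U i \<omega>, \<lambda>i. \<xi> i \<omega>))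
      = distr M (Pi\<^sub>M UNIV (\<lambda>_. borel)) (\<lambda>\<omega> i. U i \<omega>) \<Otimes>\<^sub>M distr M (Pi\<^sub>M UNIV (\<lambda>_. N)) (\<lambda>\<omega> i. \<xi> i \<omega>)"
    and G[measurable]: "Measurable.pred (borel \<Otimes>\<^sub>M N) (\<lambda>(u, z). R u z)"
  shows "emeasure M {\<omega> \<in> space M. \<forall>i<k. R (U i \<omega>) (\<xi> i \<omega>)}
    = (\<integral>\<^sup>+\<omega>. (\<Prod>i<k. emeasure \<nu> {z \<in> space N. R (U i \<omega>) z}) \<partial>M)"
proof -
  have m\<xi>[measurable]: "\<xi> i \<in> M \<rightarrow>\<^sub>M N" for i using \<xi> by (simp add: indep_vars_def)
  have [measurable]: "(\<lambda>\<omega> i. \<xi> i \<omega>) \<in> M \<rightarrow>\<^sub>M Pi\<^sub>M UNIV (\<lambda>_. N)"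
    by (intro measurable_PiM_single') (auto simp: space_PiM dest: measurable_space[OF m\<xi>])
  interpret \<nu>: prob_space \<nu> using prob_space_distr[OF m\<xi>] law by simp
  have sets_\<nu>[measurable_cong]: "sets \<nu> = sets N" using law[of 0] by (metis sets_distr)
  then have space_\<nu>: "space \<nu> = space N" by (rule sets_eq_imp_space_eq)
  interpret PP: product_prob_space "\<lambda>_::nat. \<nu>" UNIV by unfold_locales
  let ?B = "Pi\<^sub>M UNIV (\<lambda>_. borel) :: (nat \<Rightarrow> real) measure"
  let ?D = "distr M ?B (\<lambda>\<omega> i. U i \<omega>)"
  let ?P = "Pi\<^sub>M UNIV (\<lambda>_. \<nu>) :: (nat \<Rightarrow> 'n) measure"
  have sP: "sets ?P = sets (Pi\<^sub>M UNIV (\<lambda>_. N))" by (intro sets_PiM_cong) (auto simp: sets_\<nu>)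
  have dist\<xi>: "distr M (Pi\<^sub>M UNIV (\<lambda>_. N)) (\<lambda>\<omega> i. \<xi> i \<omega>) = ?P"
    using \<xi> indep_vars_iff_distr_eq_PiM[where I = UNIV and M' = "\<lambda>_. N" and X = \<xi>] law by (simp add: restrict_UNIV)
  have joint: "distr M (?B \<Otimes>\<^sub>M Pi\<^sub>M UNIV (\<lambda>_. N)) (\<lambda>\<omega>. (\<lambda>i. U i \<omega>, \<lambda>i. \<xi> i \<omega>)) = ?D \<Otimes>\<^sub>M ?P"
    using joint_distr unfolding dist\<xi> .
  define A where "A = {p \<in> space (?B \<Otimes>\<^sub>M Pi\<^sub>M UNIV (\<lambda>_. N)). \<forall>i<k. R (fst p i) (snd p i)}"
  have R[measurable (raw)]: "Measurable.pred L (\<lambda>x. R (f x) (g x))"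
    if "f \<in> borel_measurable L" "g \<in> L \<rightarrow>\<^sub>M N" for L :: "'z measure" and f g
    using measurable_compose[OF measurable_Pair[OF that] G] by simp
  have A: "A \<in> sets (?B \<Otimes>\<^sub>M Pi\<^sub>M UNIV (\<lambda>_. N))"
    unfolding A_def by measurable
  have "{\<omega> \<in> space M. \<forall>i<k. R (U i \<omega>) (\<xi> i \<omega>)} = (\<lambda>\<omega>. (\<lambda>i. U i \<omega>, \<lambda>i. \<xi> i \<omega>)) -` A \<inter> space M"
    using measurable_space[OF m\<xi>] by (auto simp: A_def space_pair_measure space_PiM)
  then have "emeasure M {\<omega> \<in> space M. \<forall>i<k. R (U i \<omega>) (\<xi> i \<omega>)} = emeasure (?D \<Otimes>\<^sub>M ?P) A"
    unfolding joint[symmetric] by (simp add: emeasure_distr A)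
  also have "\<dots> = (\<integral>\<^sup>+u. emeasure ?P (Pair u -` A) \<partial>?D)"
    using A by (intro PP.emeasure_pair_measure_alt) (simp add: sP cong: sets_pair_measure_cong)
  also have "\<dots> = (\<integral>\<^sup>+u. (\<Prod>i<k. emeasure \<nu> {z \<in> space N. R (u i) z}) \<partial>?D)"
  proof (intro nn_integral_cong)
    fix u :: "nat \<Rightarrow> real"
    have "Pair u -` A = {z \<in> space ?P. \<forall>i\<in>{..<k}. z i \<in> {z \<in> space N. R (u i) z}}"
      by (auto simp: A_def space_pair_measure space_PiM space_\<nu>)
    moreover have "{z \<in> space N. R (u i) z} \<in> sets \<nu>" for i
      unfolding sets_\<nu> by measurable
    ultimately show "emeasure ?P (Pair u -` A) = (\<Prod>i<k. emeasure \<nu> {z \<in> space N. R (u i) z})"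
      using PP.emeasure_PiM_Collect[of "{..<k}" "\<lambda>i. {z \<in> space N. R (u i) z}"] by auto
  qed
  also have "\<dots> = (\<integral>\<^sup>+\<omega>. (\<Prod>i<k. emeasure \<nu> {z \<in> space N. R (U i \<omega>) z}) \<partial>M)"
  proof (rule nn_integral_distr)
    have [measurable]: "(\<lambda>u. emeasure \<nu> {z \<in> space N. R u z}) \<in> borel_measurable borel"
    proof -
      have "(\<lambda>u. emeasure \<nu> (Pair u -` {p \<in> space (borel \<Otimes>\<^sub>M \<nu>). R (fst p) (snd p)})) \<in> borel_measurable borel"
        by (intro \<nu>.measurable_emeasure_Pair) measurable
      then show ?thesis by (simp add: space_pair_measure space_\<nu>)
    qed
    show "(\<lambda>u. \<Prod>i<k. emeasure \<nu> {z \<in> space N. R (u i) z}) \<in> borel_measurable ?D"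
      by measurable
  qed measurable
  finally show ?thesis .
qed

text \<open>Independence of the two generated sigma-algebras is the product formula on measurable
  rectangles. The map \<open>g\<close> will regroup the family indexed by pairs
  \<open>(i, t)\<close> into a sequence of marks.\<close>

lemma (in prob_space) joint_distr_process_algebra:
  assumes ind: "indep_set (process_algebra M U) (process_algebra M X)"
    and U: "\<And>i. U i \<in> borel_measurable M" and X: "\<And>i. X i \<in> borel_measurable M"
    and g[measurable]: "g \<in> Pi\<^sub>M UNIV (\<lambda>_. borel) \<rightarrow>\<^sub>M N"
  shows "distr M (Pi\<^sub>M UNIV (\<lambda>_. borel) \<Otimes>\<^sub>M N) (\<lambda>\<omega>. (\<lambda>i. U i \<omega>, g (\<lambda>i. X i \<omega>)))
    = distr M (Pi\<^sub>M UNIV (\<lambda>_. borel)) (\<lambda>\<omega> i. U i \<omega>) \<Otimes>\<^sub>M distr M N (\<lambda>\<omega>. g (\<lambda>i. X i \<omega>))"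
proof -
  have mX[measurable]: "(\<lambda>\<omega> i. X i \<omega>) \<in> M \<rightarrow>\<^sub>M Pi\<^sub>M UNIV (\<lambda>_. borel)"
    using X by (intro measurable_PiM_single') (auto simp: space_PiM)
  have mU[measurable]: "(\<lambda>\<omega> i. U i \<omega>) \<in> M \<rightarrow>\<^sub>M Pi\<^sub>M UNIV (\<lambda>_. borel)"
    using U by (intro measurable_PiM_single') (auto simp: space_PiM)
  interpret D1: prob_space "distr M (Pi\<^sub>M UNIV (\<lambda>_. borel)) (\<lambda>\<omega> i. U i \<omega>)" by (intro prob_space_distr) measurable
  interpret D2: prob_space "distr M N (\<lambda>\<omega>. g (\<lambda>i. X i \<omega>))" by (intro prob_space_distr) measurable
  show ?thesis
  proof (rule pair_measure_eqI[symmetric], goal_cases)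
    case (4 A B)
    then have A: "A \<in> sets (Pi\<^sub>M UNIV (\<lambda>_. borel))" and B: "B \<in> sets N" by auto
    let ?A = "(\<lambda>\<omega> i. U i \<omega>) -` A \<inter> space M" and ?B = "(\<lambda>\<omega>. g (\<lambda>i. X i \<omega>)) -` B \<inter> space M"
    have "?A \<in> process_algebra M U"
      unfolding process_algebra_def using A by (intro in_vimage_algebra)
    moreover have "?B = (\<lambda>\<omega> i. X i \<omega>) -` (g -` B \<inter> space (Pi\<^sub>M UNIV (\<lambda>_. borel))) \<inter> space M"
      by (auto simp: space_PiM)
    then have "?B \<in> process_algebra M X"
      unfolding process_algebra_def using measurable_sets[OF g B] by (metis in_vimage_algebra)
    ultimately have "prob (?A \<inter> ?B) = prob ?A * prob ?B" by (rule indep_setD[OF ind])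
    moreover have "(\<lambda>\<omega>. (\<lambda>i. U i \<omega>, g (\<lambda>i. X i \<omega>))) -` (A \<times> B) \<inter> space M = ?A \<inter> ?B" by auto
    ultimately show ?case
      using A B by (simp add: emeasure_distr emeasure_eq_measure ennreal_mult)
  qed (auto intro: D1.sigma_finite_measure_axioms D2.sigma_finite_measure_axioms
      simp: cong: sets_pair_measure_cong)
qed

lemma sup_process_measurable:
  assumes "\<And>i. U i \<in> borel_measurable M" "\<And>i. V i t \<in> borel_measurable M"
  shows "sup_process P W U V t \<in> borel_measurable M"
proof -
  note [measurable] = assms
  show ?thesis unfolding sup_process_def by measurable
qed

text \<open>The event says that no marked point breaks a bound on \<open>S\<close>. A point at
  height \<open>u\<close> breaks one with probability \<open>h u\<close>, independently given the
  heights, so the Laplace functional at \<open>h\<close> is the probability sought. The intensity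
  integral of \<open>h\<close> is the expected maximum on the right.\<close>

lemma sup_process_cdf:
  fixes W :: "'t \<Rightarrow> 'p \<Rightarrow> real" and U :: "nat \<Rightarrow> 'a \<Rightarrow> real"
  assumes V: "indep_copies M UNIV V P W"
    and U: "poisson_point_process M U exp_intensity"
    and ind: "prob_space.indep_set M (process_algebra M U) (process_algebra M (\<lambda>(i, t). V i t))"
    and S: "finite S"
    and fin: "(\<integral>\<^sup>+\<omega>. (SUP t\<in>S. ennreal (exp (W t \<omega> - prob_space.variance P (W t) / 2 - y t))) \<partial>P) < \<infinity>"
  shows "measure M {\<omega> \<in> space M. \<forall>t\<in>S. sup_process P W U V t \<omega> \<le> ereal (y t)}
    = exp (- enn2real (\<integral>\<^sup>+\<omega>. (SUP t\<in>S. ennreal (exp (W t \<omega> - prob_space.variance P (W t) / 2 - y t))) \<partial>P))"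
proof -
  interpret M: prob_space M using V by (simp add: indep_copies_def)
  interpret M: poisson_points M U exp_intensity
    by unfold_locales (rule U | simp add: exp_intensity_def)+
  interpret P: prob_space P using V by (simp add: indep_copies_def same_law_def stoch_process_def)
  have V_meas[measurable]: "V i t \<in> borel_measurable M" for i t
    using V by (simp add: indep_copies_def same_law_def stoch_process_def)
  have W_meas[measurable]: "W t \<in> borel_measurable P" for t
    using V by (simp add: indep_copies_def same_law_def stoch_process_def)
  \<comment> \<open>\<open>x z t\<close> is the greatest height at which a point with mark
    \<open>z\<close> still respects the bound at \<open>t\<close>.\<close>
  define x where "x z t = y t + P.variance (W t) / 2 - z t" for z t
  define R where "R u z \<longleftrightarrow> (\<forall>t\<in>S. u \<le> x z t)" for u z
  let ?N = "Pi\<^sub>M S (\<lambda>_. borel) :: ('t \<Rightarrow> real) measure"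
  define \<xi> where "\<xi> i \<omega> = (\<lambda>t\<in>S. V i t \<omega>)" for i \<omega>
  define \<nu> where "\<nu> = distr P ?N (\<lambda>\<omega>. \<lambda>t\<in>S. W t \<omega>)"
  interpret \<nu>: prob_space \<nu> unfolding \<nu>_def by (intro P.prob_space_distr) measurable
  have sets_\<nu>[measurable_cong, simp]: "sets \<nu> = sets ?N" and space_\<nu>[simp]: "space \<nu> = space ?N"
    by (simp_all add: \<nu>_def)
  have x_meas: "t \<in> S \<Longrightarrow> (\<lambda>z. x z t) \<in> borel_measurable ?N" for t
    unfolding x_def by measurable
  have R_meas[measurable]: "Measurable.pred (borel \<Otimes>\<^sub>M ?N) (\<lambda>(u, z). R u z)"
    unfolding R_def case_prod_beta
  proof (intro pred_intros_finite S)
    fix t assume "t \<in> S"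
    note [measurable] = x_meas[OF this]
    show "Measurable.pred (borel \<Otimes>\<^sub>M ?N) (\<lambda>p. fst p \<le> x (snd p) t)" by measurable
  qed
  have "M.indep_vars (\<lambda>_. ?N) (\<lambda>i \<omega>. restrict (\<lambda>t. V i t \<omega>) S) UNIV"
    using V unfolding indep_copies_def
    by (elim conjE M.indep_vars_compose2) (intro measurable_restrict measurable_component_singleton; simp)
  then have ind_\<xi>: "M.indep_vars (\<lambda>_. ?N) \<xi> UNIV" by (simp add: \<xi>_def[abs_def])
  have law_\<xi>: "distr M ?N (\<xi> i) = \<nu>" for i
    using V S by (simp add: indep_copies_def same_law_def \<xi>_def[abs_def] \<nu>_def)
  have joint: "distr M (Pi\<^sub>M UNIV (\<lambda>_. borel) \<Otimes>\<^sub>M Pi\<^sub>M UNIV (\<lambda>_. ?N)) (\<lambda>\<omega>. (\<lambda>i. U i \<omega>, \<lambda>i. \<xi> i \<omega>))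
      = distr M (Pi\<^sub>M UNIV (\<lambda>_. borel)) (\<lambda>\<omega> i. U i \<omega>) \<Otimes>\<^sub>M distr M (Pi\<^sub>M UNIV (\<lambda>_. ?N)) (\<lambda>\<omega> i. \<xi> i \<omega>)"
  proof -
    let ?g = "\<lambda>f :: nat \<times> 't \<Rightarrow> real. \<lambda>i. \<lambda>t\<in>S. f (i, t)"
    have "?g \<in> Pi\<^sub>M UNIV (\<lambda>_. borel) \<rightarrow>\<^sub>M Pi\<^sub>M UNIV (\<lambda>_. ?N)"
      by (intro measurable_PiM_single' measurable_restrict) (auto simp: space_PiM)
    from M.joint_distr_process_algebra[OF ind _ _ this] show ?thesis
      by (simp add: \<xi>_def split_beta)
  qed
  define h where "h u = measure \<nu> {z \<in> space ?N. \<not> R u z}" for u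
  have [measurable]: "{z \<in> space ?N. R u z} \<in> sets ?N" "{z \<in> space ?N. \<not> R u z} \<in> sets ?N" for u
    using measurable_compose[OF measurable_Pair1' R_meas, of u] by auto
  have R_meas'[measurable (raw)]: "Measurable.pred L (\<lambda>x. R (f x) (g x))"
    if "f \<in> borel_measurable L" "g \<in> L \<rightarrow>\<^sub>M ?N" for L :: "'z measure" and f g
    using measurable_compose[OF measurable_Pair[OF that] R_meas] by simp
  have ind_meas: "(\<lambda>z. indicator {p. \<not> R (fst p) (snd p)} (u, z) :: ennreal) \<in> borel_measurable \<nu>" for u
    by (subst measurable_cong[where g = "indicator {z \<in> space ?N. \<not> R u z}"]) (auto simp: indicator_def)
  have h_eq: "ennreal (h u) = (\<integral>\<^sup>+z. indicator {p. \<not> R (fst p) (snd p)} (u, z) \<partial>\<nu>)" for u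
  proof -
    have "(\<integral>\<^sup>+z. indicator {p. \<not> R (fst p) (snd p)} (u, z) \<partial>\<nu>) = (\<integral>\<^sup>+z. indicator {z \<in> space ?N. \<not> R u z} z \<partial>\<nu>)"
      by (intro nn_integral_cong) (auto simp: indicator_def)
    then show ?thesis by (simp add: h_def \<nu>.emeasure_eq_measure)
  qed
  have h01: "0 \<le> h u" "h u \<le> 1" for u by (auto simp: h_def)
  have h_meas[measurable]: "h \<in> borel_measurable borel"
  proof -
    have "(\<lambda>u. enn2real (\<integral>\<^sup>+z. indicator {p. \<not> R (fst p) (snd p)} (u, z) \<partial>\<nu>)) \<in> borel_measurable borel"
      by measurable
    then show ?thesis by (simp add: h_eq[symmetric] h01)
  qed
  have h_compl: "emeasure \<nu> {z \<in> space ?N. R u z} = ennreal (1 - h u)" for u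
  proof -
    have "{z \<in> space ?N. R u z} = space \<nu> - {z \<in> space ?N. \<not> R u z}" by auto
    then show ?thesis
      using \<nu>.prob_compl[of "{z \<in> space ?N. \<not> R u z}"] by (simp add: h_def \<nu>.emeasure_eq_measure)
  qed
  have int_h: "(\<integral>\<^sup>+u. ennreal (h u) \<partial>exp_intensity)
    = (\<integral>\<^sup>+\<omega>. (SUP t\<in>S. ennreal (exp (W t \<omega> - P.variance (W t) / 2 - y t))) \<partial>P)"
  proof -
    \<comment> \<open>The height is integrated first: for a fixed mark the forbidden heights form a
      union of half lines, whose intensity is known.\<close>
    interpret pair_sigma_finite lborel \<nu> by unfold_locales
    have "(\<integral>\<^sup>+u. ennreal (h u) \<partial>exp_intensity) = (\<integral>\<^sup>+u. ennreal (exp (- u)) * ennreal (h u) \<partial>lborel)"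
      unfolding exp_intensity_def by (subst nn_integral_density) auto
    also have "\<dots> = (\<integral>\<^sup>+u. \<integral>\<^sup>+z. ennreal (exp (- u)) * indicator {p. \<not> R (fst p) (snd p)} (u, z) \<partial>\<nu> \<partial>lborel)"
      unfolding h_eq by (intro nn_integral_cong nn_integral_cmult[symmetric] ind_meas)
    also have "\<dots> = (\<integral>\<^sup>+z. \<integral>\<^sup>+u. ennreal (exp (- u)) * indicator {p. \<not> R (fst p) (snd p)} (u, z) \<partial>lborel \<partial>\<nu>)"
      by (rule Fubini'[symmetric]) measurable
    also have "\<dots> = (\<integral>\<^sup>+z. (SUP t\<in>S. ennreal (exp (- x z t))) \<partial>\<nu>)"
    proof (intro nn_integral_cong)
      fix z
      have "{u. \<exists>t\<in>S. u > x z t} = (\<Union>t\<in>S. {x z t<..})" by auto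
      then have [measurable]: "{u. \<exists>t\<in>S. u > x z t} \<in> sets borel" using S by auto
      have "(\<integral>\<^sup>+u. ennreal (exp (- u)) * indicator {p. \<not> R (fst p) (snd p)} (u, z) \<partial>lborel)
        = (\<integral>\<^sup>+u. ennreal (exp (- u)) * indicator {u. \<exists>t\<in>S. u > x z t} u \<partial>lborel)"
        by (intro nn_integral_cong) (auto simp: R_def indicator_def not_le)
      also have "\<dots> = emeasure exp_intensity {u. \<exists>t\<in>S. u > x z t}"
        unfolding exp_intensity_def by (subst emeasure_density) auto
      finally show "(\<integral>\<^sup>+u. ennreal (exp (- u)) * indicator {p. \<not> R (fst p) (snd p)} (u, z) \<partial>lborel)
        = (SUP t\<in>S. ennreal (exp (- x z t)))"
        by (simp add: emeasure_exp_intensity_UN_greaterThan[OF S])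
    qed
    also have "\<dots> = (\<integral>\<^sup>+\<omega>. (SUP t\<in>S. ennreal (exp (- x (\<lambda>t\<in>S. W t \<omega>) t))) \<partial>P)"
      unfolding \<nu>_def
    proof (rule nn_integral_distr)
      have "(\<lambda>z. SUP t\<in>S. ennreal (exp (- x z t))) \<in> borel_measurable ?N"
        using x_meas by (intro borel_measurable_SUP countable_finite S) measurable
      then show "(\<lambda>z. SUP t\<in>S. ennreal (exp (- x z t))) \<in> borel_measurable (distr P ?N (\<lambda>\<omega>. \<lambda>t\<in>S. W t \<omega>))"
        by simp
    qed measurable
    also have "\<dots> = (\<integral>\<^sup>+\<omega>. (SUP t\<in>S. ennreal (exp (W t \<omega> - P.variance (W t) / 2 - y t))) \<partial>P)"
      by (intro nn_integral_cong SUP_cong) (auto simp: x_def algebra_simps)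
    finally show ?thesis .
  qed
  \<comment> \<open>Constraining only the first \<open>k\<close> points gives decreasing events,
    whose intersection is the event in question.\<close>
  define E where "E k = {\<omega> \<in> space M. \<forall>i<k. R (U i \<omega>) (\<xi> i \<omega>)}" for k :: nat
  have \<xi>_meas[measurable]: "\<xi> i \<in> M \<rightarrow>\<^sub>M ?N" for i unfolding \<xi>_def by measurable
  have E_meas[measurable]: "E k \<in> sets M" for k unfolding E_def by measurable
  have U_meas: "(\<lambda>\<omega> i. U i \<omega>) \<in> M \<rightarrow>\<^sub>M Pi\<^sub>M UNIV (\<lambda>_. borel)"
    by (intro measurable_PiM_single') (auto simp: space_PiM)
  have "emeasure M (E k) = (\<integral>\<^sup>+\<omega>. ennreal (\<Prod>i<k. 1 - h (U i \<omega>)) \<partial>M)" for k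
    unfolding E_def M.prob_marked_points[OF ind_\<xi> law_\<xi> U_meas joint R_meas] h_compl
    using h01 by (simp add: prod_ennreal)
  then have "(\<lambda>k. emeasure M (E k)) \<longlonglongrightarrow> ennreal (exp (- enn2real (\<integral>\<^sup>+u. ennreal (h u) \<partial>exp_intensity)))"
    using M.laplace_functional[OF h_meas h01] fin int_h by simp
  moreover have "(\<lambda>k. emeasure M (E k)) \<longlonglongrightarrow> emeasure M (\<Inter>k. E k)"
    by (intro Lim_emeasure_decseq) (auto simp: E_def decseq_def)
  ultimately have "emeasure M (\<Inter>k. E k) = ennreal (exp (- enn2real (\<integral>\<^sup>+u. ennreal (h u) \<partial>exp_intensity)))"
    by (intro LIMSEQ_unique)
  moreover have "(\<Inter>k. E k) = {\<omega> \<in> space M. \<forall>t\<in>S. sup_process P W U V t \<omega> \<le> ereal (y t)}"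
  proof -
    have "(\<forall>t\<in>S. sup_process P W U V t \<omega> \<le> ereal (y t)) \<longleftrightarrow> (\<forall>i. R (U i \<omega>) (\<xi> i \<omega>))" for \<omega>
      by (auto simp: sup_process_def SUP_le_iff R_def x_def \<xi>_def algebra_simps)
    then show ?thesis by (auto simp: E_def)
  qed
  ultimately show ?thesis
    by (simp add: measure_def int_h)
qed

subsection \<open>Laws of processes with extended real values\<close>

text \<open>Boxes constraining all coordinates by real bounds do not suffice: they do not separate points
  with an infinite coordinate, hence the subsets \<open>S\<close>.\<close>

lemma sets_PiM_ereal_boxes:
  fixes T :: "'i set"
  assumes "finite T"
  shows "sets (Pi\<^sub>M T (\<lambda>_. borel :: ereal measure))
    = sigma_sets (Pi\<^sub>E T (\<lambda>_. UNIV)) {{f \<in> Pi\<^sub>E T (\<lambda>_. UNIV). \<forall>t\<in>S. f t \<le> ereal (y t)} | S y. S \<subseteq> T}"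
    (is "sets ?P = sigma_sets ?\<Omega> ?E")
proof (intro equalityI subsetI)
  let ?\<Sigma> = "sigma ?\<Omega> ?E"
  have E: "?E \<subseteq> Pow ?\<Omega>" by auto
  have in_E: "{f \<in> ?\<Omega>. f t \<le> ereal a} \<in> sets ?\<Sigma>" if "t \<in> T" for t a
    using that E by (auto intro!: sigma_sets.Basic exI[of _ "{t}"] exI[of _ "\<lambda>_. a"])
  have comp: "(\<lambda>f. f t) \<in> borel_measurable ?\<Sigma>" if t: "t \<in> T" for t
    unfolding borel_measurable_iff_Iic_ereal
  proof
    fix a :: ereal
    show "(\<lambda>f. f t) -` {..a} \<inter> space ?\<Sigma> \<in> sets ?\<Sigma>"
    proof (cases a)
      case (real r)
      moreover have "(\<lambda>f. f t) -` {..ereal r} \<inter> space ?\<Sigma> = {f \<in> ?\<Omega>. f t \<le> ereal r}" using E by auto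
      ultimately show ?thesis using in_E[OF t] by simp
    next
      case PInf
      then have "(\<lambda>f. f t) -` {..a} \<inter> space ?\<Sigma> = space ?\<Sigma>" by auto
      then show ?thesis by (simp only: sets.top)
    next
      case MInf
      \<comment> \<open>All generators have real bounds, so the constraint with bound
        \<open>-\<infinity>\<close> is recovered as a countable intersection over the bounds
        \<open>- real n\<close>.\<close>
      have bot: "x = -\<infinity>" if "\<And>n::nat. x \<le> ereal (- real n)" for x
      proof (rule ereal_bot)
        fix b :: real
        obtain n :: nat where "- b \<le> real n" using real_arch_simple by auto
        then have "ereal (- real n) \<le> ereal b" by simp
        with that[of n] show "x \<le> ereal b" by (rule order_trans)
      qed
      have "x \<le> a \<longleftrightarrow> (\<forall>n::nat. x \<le> ereal (- real n))" for x
        using bot[of x] MInf by auto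
      then have "(\<lambda>f. f t) -` {..a} \<inter> space ?\<Sigma> = (\<Inter>n::nat. {f \<in> ?\<Omega>. f t \<le> ereal (- real n)})"
        using E by (simp add: vimage_def set_eq_iff space_measure_of) auto
      moreover have "(\<Inter>n::nat. {f \<in> ?\<Omega>. f t \<le> ereal (- real n)}) \<in> sets ?\<Sigma>"
        using in_E[OF t] by (intro sets.countable_INT) auto
      ultimately show ?thesis by simp
    qed
  qed
  have id: "(\<lambda>f. f) \<in> ?\<Sigma> \<rightarrow>\<^sub>M ?P"
    using E comp by (intro measurable_PiM_single') (auto simp: space_measure_of)
  fix A assume "A \<in> sets ?P"
  then have "(\<lambda>f. f) -` A \<inter> space ?\<Sigma> \<in> sets ?\<Sigma>" by (rule measurable_sets[OF id])
  moreover have "A \<subseteq> ?\<Omega>" using sets.sets_into_space[OF \<open>A \<in> sets ?P\<close>] by (simp add: space_PiM)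
  ultimately show "A \<in> sigma_sets ?\<Omega> ?E" using E by (simp add: space_measure_of Int_absorb2)
next
  fix A assume A: "A \<in> sigma_sets ?\<Omega> ?E"
  have "?E \<subseteq> sets ?P"
  proof safe
    fix S y assume "S \<subseteq> T"
    then have "finite S" using assms finite_subset by blast
    have "{f \<in> space ?P. \<forall>t\<in>S. f t \<le> ereal (y t)} \<in> sets ?P"
    proof (intro sets.sets_Collect_finite_All \<open>finite S\<close>)
      fix t assume "t \<in> S"
      then have "t \<in> T" using \<open>S \<subseteq> T\<close> by auto
      then show "{f \<in> space ?P. f t \<le> ereal (y t)} \<in> sets ?P" by measurable
    qed
    then show "{f \<in> ?\<Omega>. \<forall>t\<in>S. f t \<le> ereal (y t)} \<in> sets ?P" by (simp add: space_PiM)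
  qed
  then have "sigma_sets (space ?P) ?E \<subseteq> sets ?P" by (rule sets.sigma_sets_subset)
  with A show "A \<in> sets ?P" by (auto simp: space_PiM)
qed

text \<open>Boxes with real bounds on a subset of the coordinates are stable under intersection and
  generate the product sigma-algebra, so they determine each finite-dimensional law. The empty
  \<open>S\<close> supplies the whole space.\<close>

lemma same_law_erealI:
  fixes X :: "'i \<Rightarrow> 'a \<Rightarrow> ereal" and Y :: "'i \<Rightarrow> 'b \<Rightarrow> ereal"
  assumes X: "stoch_process M X" and Y: "stoch_process N Y"
    and eq: "\<And>S y. finite S \<Longrightarrow> measure M {\<omega> \<in> space M. \<forall>t\<in>S. X t \<omega> \<le> ereal (y t)}
      = measure N {\<omega> \<in> space N. \<forall>t\<in>S. Y t \<omega> \<le> ereal (y t)}"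
  shows "same_law M X N Y"
  unfolding same_law_def
proof (intro conjI X Y allI impI)
  fix T :: "'i set" assume T: "finite T"
  interpret M: prob_space M using X by (simp add: stoch_process_def)
  interpret N: prob_space N using Y by (simp add: stoch_process_def)
  have [measurable]: "X t \<in> borel_measurable M" "Y t \<in> borel_measurable N" for t
    using X Y by (auto simp: stoch_process_def)
  let ?P = "Pi\<^sub>M T (\<lambda>_. borel :: ereal measure)" and ?\<Omega> = "Pi\<^sub>E T (\<lambda>_. UNIV :: ereal set)"
  let ?E = "{{f \<in> ?\<Omega>. \<forall>t\<in>S. f t \<le> ereal (y t)} | S y. S \<subseteq> T}"
  have mX: "(\<lambda>\<omega>. \<lambda>t\<in>T. X t \<omega>) \<in> M \<rightarrow>\<^sub>M ?P" and mY: "(\<lambda>\<omega>. \<lambda>t\<in>T. Y t \<omega>) \<in> N \<rightarrow>\<^sub>M ?P"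
    by measurable
  show "distr M ?P (\<lambda>\<omega>. \<lambda>t\<in>T. X t \<omega>) = distr N ?P (\<lambda>\<omega>. \<lambda>t\<in>T. Y t \<omega>)"
  proof (rule measure_eqI_generator_eq)
    show "Int_stable ?E"
    proof (rule Int_stableI)
      fix A B assume "A \<in> ?E" "B \<in> ?E"
      then obtain S y S' y' where S: "S \<subseteq> T" "S' \<subseteq> T"
        and A: "A = {f \<in> ?\<Omega>. \<forall>t\<in>S. f t \<le> ereal (y t)}" and B: "B = {f \<in> ?\<Omega>. \<forall>t\<in>S'. f t \<le> ereal (y' t)}"
        by auto
      define z where "z t = (if t \<in> S then if t \<in> S' then min (y t) (y' t) else y t else y' t)" for t
      have min: "x \<le> ereal (min a b) \<longleftrightarrow> x \<le> ereal a \<and> x \<le> ereal b" for x :: ereal and a b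
        by (cases x) auto
      have "A \<inter> B = {f \<in> ?\<Omega>. \<forall>t\<in>S \<union> S'. f t \<le> ereal (z t)}"
        unfolding A B z_def by (auto simp: min simp del: ereal_min split: if_splits)
      moreover have "S \<union> S' \<subseteq> T" using S by auto
      ultimately show "A \<inter> B \<in> ?E" unfolding mem_Collect_eq by (intro exI conjI)
    qed
    fix A assume "A \<in> ?E"
    then obtain S y where S: "S \<subseteq> T" and A: "A = {f \<in> ?\<Omega>. \<forall>t\<in>S. f t \<le> ereal (y t)}" by auto
    have AP: "A \<in> sets ?P" unfolding sets_PiM_ereal_boxes[OF T] using \<open>A \<in> ?E\<close> by (rule sigma_sets.Basic)
    have "(\<lambda>\<omega>. \<lambda>t\<in>T. X t \<omega>) -` A \<inter> space M = {\<omega> \<in> space M. \<forall>t\<in>S. X t \<omega> \<le> ereal (y t)}"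
      "(\<lambda>\<omega>. \<lambda>t\<in>T. Y t \<omega>) -` A \<inter> space N = {\<omega> \<in> space N. \<forall>t\<in>S. Y t \<omega> \<le> ereal (y t)}"
      using S by (auto simp: A subset_iff)
    then show "emeasure (distr M ?P (\<lambda>\<omega>. \<lambda>t\<in>T. X t \<omega>)) A = emeasure (distr N ?P (\<lambda>\<omega>. \<lambda>t\<in>T. Y t \<omega>)) A"
      using eq[OF finite_subset[OF S T], of y]
      by (simp add: emeasure_distr mX mY AP M.emeasure_eq_measure N.emeasure_eq_measure)
  next
    show "range (\<lambda>_::nat. ?\<Omega>) \<subseteq> ?E" by (auto intro!: exI[of _ "{}"])
  next
    show "emeasure (distr M ?P (\<lambda>\<omega>. \<lambda>t\<in>T. X t \<omega>)) ?\<Omega> \<noteq> \<infinity>" for i :: nat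
      using finite_measure.emeasure_finite[OF prob_space.finite_measure[OF M.prob_space_distr[OF mX]]] by simp
  qed (auto simp: sets_PiM_ereal_boxes[OF T])
qed

lemma same_law_prob_box:
  fixes X :: "'i \<Rightarrow> 'a \<Rightarrow> ereal" and Y :: "'i \<Rightarrow> 'b \<Rightarrow> ereal"
  assumes "same_law M X N Y" and S: "finite S"
  shows "measure M {\<omega> \<in> space M. \<forall>t\<in>S. X t \<omega> \<le> ereal (y t)} = measure N {\<omega> \<in> space N. \<forall>t\<in>S. Y t \<omega> \<le> ereal (y t)}"
proof -
  let ?P = "Pi\<^sub>M S (\<lambda>_. borel :: ereal measure)"
  have [measurable]: "X t \<in> borel_measurable M" "Y t \<in> borel_measurable N" for t
    using assms by (auto simp: same_law_def stoch_process_def)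
  have mX: "(\<lambda>\<omega>. \<lambda>t\<in>S. X t \<omega>) \<in> M \<rightarrow>\<^sub>M ?P" and mY: "(\<lambda>\<omega>. \<lambda>t\<in>S. Y t \<omega>) \<in> N \<rightarrow>\<^sub>M ?P"
    by measurable
  define A where "A = {f \<in> Pi\<^sub>E S (\<lambda>_. UNIV :: ereal set). \<forall>t\<in>S. f t \<le> ereal (y t)}"
  have A: "A \<in> sets ?P" unfolding sets_PiM_ereal_boxes[OF S] A_def by (rule sigma_sets.Basic) auto
  have "(\<lambda>\<omega>. \<lambda>t\<in>S. X t \<omega>) -` A \<inter> space M = {\<omega> \<in> space M. \<forall>t\<in>S. X t \<omega> \<le> ereal (y t)}"
    "(\<lambda>\<omega>. \<lambda>t\<in>S. Y t \<omega>) -` A \<inter> space N = {\<omega> \<in> space N. \<forall>t\<in>S. Y t \<omega> \<le> ereal (y t)}"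
    by (auto simp: A_def)
  moreover have "measure (distr M ?P (\<lambda>\<omega>. \<lambda>t\<in>S. X t \<omega>)) A = measure (distr N ?P (\<lambda>\<omega>. \<lambda>t\<in>S. Y t \<omega>)) A"
    using assms by (simp add: same_law_def)
  ultimately show ?thesis by (simp add: measure_distr mX mY A)
qed

section \<open>Increments and shifts of Gaussian processes\<close>

lemma same_law_integral:
  fixes X :: "'i \<Rightarrow> 'a \<Rightarrow> real" and Y :: "'i \<Rightarrow> 'b \<Rightarrow> real" and f :: "real \<Rightarrow> real"
  assumes "same_law M X N Y" and [measurable]: "f \<in> borel_measurable borel"
  shows "(\<integral>\<omega>. f (X t \<omega>) \<partial>M) = (\<integral>\<omega>. f (Y t \<omega>) \<partial>N)"
proof -
  let ?P = "Pi\<^sub>M {t} (\<lambda>_. borel :: real measure)"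
  have [measurable]: "X t \<in> borel_measurable M" "Y t \<in> borel_measurable N" for t
    using assms by (auto simp: same_law_def stoch_process_def)
  have "(\<integral>z. f (z t) \<partial>distr M ?P (\<lambda>\<omega>. \<lambda>t\<in>{t}. X t \<omega>)) = (\<integral>z. f (z t) \<partial>distr N ?P (\<lambda>\<omega>. \<lambda>t\<in>{t}. Y t \<omega>))"
    using assms by (simp add: same_law_def)
  then show ?thesis by (subst (asm) (1 2) integral_distr) (simp_all, measurable)
qed

text \<open>Stationarity of the increments moves the base point from \<open>t\<close> to
  \<open>0\<close>, where the variogram is defined. This is the only place where that hypothesis
  enters.\<close>

lemma centered_gaussian_si_increment:
  assumes "centered_gaussian_si P W"
  shows "integral\<^sup>L P (\<lambda>\<omega>. (W s \<omega> - W t \<omega>)\<^sup>2) = variogram P W (s - t)"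
proof -
  have "same_law P (\<lambda>u \<omega>. W (u + t) \<omega> - W t \<omega>) P (\<lambda>u \<omega>. W (u + 0) \<omega> - W 0 \<omega>)"
    using assms unfolding centered_gaussian_si_def stationary_increments_def by blast
  from same_law_integral[OF this, of "\<lambda>x. x\<^sup>2" "s - t"] show ?thesis
    by (simp add: variogram_def)
qed

lemma gaussian_process_shift:
  fixes X :: "'t::ab_group_add \<Rightarrow> 'a \<Rightarrow> real"
  assumes "gaussian_process M X"
  shows "gaussian_process M (\<lambda>t. X (t + h))"
  unfolding gaussian_process_def
proof (intro conjI allI impI)
  show "stoch_process M (\<lambda>t. X (t + h))"
    using assms by (simp add: gaussian_process_def stoch_process_def)
  fix T :: "'t set" and a :: "'t \<Rightarrow> real" assume "finite T"
  then have "gaussian_rv M (\<lambda>\<omega>. \<Sum>t\<in>(\<lambda>t. t + h) ` T. a (t - h) * X t \<omega>)"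
    using assms by (simp add: gaussian_process_def)
  moreover have "(\<Sum>t\<in>(\<lambda>t. t + h) ` T. a (t - h) * X t \<omega>) = (\<Sum>t\<in>T. a t * X (t + h) \<omega>)" for \<omega>
    by (subst sum.reindex) (auto simp: inj_on_def)
  ultimately show "gaussian_rv M (\<lambda>\<omega>. \<Sum>t\<in>T. a t * X (t + h) \<omega>)" by simp
qed

section \<open>The Brown-Resnick process and its exponent\<close>

locale brown_resnick =
  fixes P :: "'p measure" and W :: "'t::ab_group_add \<Rightarrow> 'p \<Rightarrow> real"
    and M :: "'a measure" and V :: "nat \<Rightarrow> 't \<Rightarrow> 'a \<Rightarrow> real" and U :: "nat \<Rightarrow> 'a \<Rightarrow> real"
  assumes W: "centered_gaussian_si P W"
    and V: "indep_copies M UNIV V P W"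
    and U: "poisson_point_process M U exp_intensity"
    and UV: "prob_space.indep_set M (process_algebra M U) (process_algebra M (\<lambda>(i, t). V i t))"
begin

sublocale M: prob_space M using V by (simp add: indep_copies_def)

sublocale P: prob_space P using V by (simp add: indep_copies_def same_law_def stoch_process_def)

lemma W_gaussian: "gaussian_process P W" and W_centered: "P.expectation (W t) = 0"
  using W by (auto simp: centered_gaussian_si_def)

lemma W_measurable [measurable]: "W t \<in> borel_measurable P"
  by (rule P.gaussian_process_measurable[OF W_gaussian])

abbreviation \<eta> :: "'t \<Rightarrow> 'a \<Rightarrow> ereal" where "\<eta> \<equiv> sup_process P W U V"

lemma \<eta>_measurable [measurable]: "\<eta> t \<in> borel_measurable M"
  using V U by (intro sup_process_measurable)
    (auto simp: indep_copies_def same_law_def poisson_point_process_def stoch_process_def)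

text \<open>This will be minus the logarithm of the finite-dimensional distribution function: the
  exponent function of extreme value theory, written for Gumbel margins. Extended values let
  finiteness be proved afterwards.\<close>

definition exponent :: "'t set \<Rightarrow> ('t \<Rightarrow> real) \<Rightarrow> ennreal" where
  "exponent S y = (\<integral>\<^sup>+\<omega>. (SUP t\<in>S. ennreal (exp (W t \<omega> - P.variance (W t) / 2 - y t))) \<partial>P)"

text \<open>The drift, minus half the variance, normalises \<open>exp (W t)\<close> to expectation
  one; this is the origin of the standard Gumbel margins.\<close>

lemma exponent_singleton: "exponent {t} y = ennreal (exp (- y t))"
proof -
  let ?v = "P.variance (W t)"
  have "(\<integral>\<^sup>+\<omega>. ennreal (exp (W t \<omega>)) \<partial>P) = ennreal (exp (?v / 2))"
    using P.gaussian_rv_mgf[OF P.gaussian_process_rv[OF W_gaussian] W_centered] W_centered by simp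
  moreover have "exponent {t} y = (\<integral>\<^sup>+\<omega>. ennreal (exp (- ?v / 2 - y t)) * ennreal (exp (W t \<omega>)) \<partial>P)"
    unfolding exponent_def
    by (intro nn_integral_cong) (simp add: ennreal_mult[symmetric] exp_add[symmetric] algebra_simps)
  ultimately have "exponent {t} y = ennreal (exp (- ?v / 2 - y t)) * ennreal (exp (?v / 2))"
    by (simp add: nn_integral_cmult)
  then show ?thesis by (simp add: ennreal_mult[symmetric] exp_add[symmetric])
qed

text \<open>A maximum of nonnegative terms is at most their sum, and the singletons are
  known.\<close>

lemma exponent_finite:
  assumes "finite S"
  shows "exponent S y < \<infinity>"
proof -
  have "exponent S y \<le> (\<integral>\<^sup>+\<omega>. (\<Sum>t\<in>S. ennreal (exp (W t \<omega> - P.variance (W t) / 2 - y t))) \<partial>P)"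
    unfolding exponent_def using assms
    by (intro nn_integral_mono SUP_least member_le_sum) auto
  also have "\<dots> = (\<Sum>t\<in>S. exponent {t} y)"
    unfolding exponent_def by (subst nn_integral_sum) auto
  also have "\<dots> < \<infinity>" using assms by (simp add: exponent_singleton less_top)
  finally show ?thesis .
qed

text \<open>This homogeneity is max-stability in analytic form: the maximum of \<open>n\<close>
  independent copies has \<open>n\<close> times the exponent, and so does the process raised by
  \<open>ln n\<close>.\<close>

lemma exponent_scale:
  assumes "c > 0" "finite S"
  shows "exponent S (\<lambda>t. y t - ln c) = ennreal c * exponent S y"
proof -
  have "(SUP t\<in>S. ennreal (exp (W t \<omega> - P.variance (W t) / 2 - (y t - ln c))))
     = ennreal c * (SUP t\<in>S. ennreal (exp (W t \<omega> - P.variance (W t) / 2 - y t)))" for \<omega>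
  proof (cases "S = {}")
    case False
    then show ?thesis
      using assms by (subst SUP_mult_left_ennreal)
        (auto intro!: SUP_cong simp: ennreal_mult[symmetric] exp_diff)
  qed (simp add: bot_ennreal)
  moreover have "(\<lambda>\<omega>. SUP t\<in>S. ennreal (exp (W t \<omega> - P.variance (W t) / 2 - y t))) \<in> borel_measurable P"
    using assms by (intro borel_measurable_SUP countable_finite) measurable
  ultimately show ?thesis
    unfolding exponent_def by (simp add: nn_integral_cmult)
qed

text \<open>The shifted process may have other variances, but its increments keep their second
  moments because \<open>(s + h) - (t + h) = s - t\<close>. Stationarity of \<open>\<eta>\<close>
  rests on this.\<close>

lemma exponent_shift:
  assumes "finite S"
  shows "exponent ((\<lambda>t. t + h) ` S) (\<lambda>u. y (u - h)) = exponent S y"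
proof -
  have "exponent ((\<lambda>t. t + h) ` S) (\<lambda>u. y (u - h))
    = (\<integral>\<^sup>+\<omega>. (SUP t\<in>S. ennreal (exp (W (t + h) \<omega> - P.variance (W (t + h)) / 2 - y t))) \<partial>P)"
    by (simp add: exponent_def image_comp)
  also have "\<dots> = exponent S y"
    unfolding exponent_def
    using centered_gaussian_si_increment[OF W]
    by (intro gaussian_sup_exp_eq gaussian_process_shift W_gaussian W_centered assms) simp
  finally show ?thesis .
qed

lemma \<eta>_cdf:
  assumes "finite S"
  shows "M.prob {\<omega> \<in> space M. \<forall>t\<in>S. \<eta> t \<omega> \<le> ereal (y t)} = exp (- enn2real (exponent S y))"
  unfolding exponent_def using sup_process_cdf[OF V U UV assms] exponent_finite[OF assms, of y]
  by (simp add: exponent_def)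

lemma \<eta>_process: "stoch_process M \<eta>"
  by (simp add: stoch_process_def M.prob_space_axioms)

lemma \<eta>_stationary: "stationary_process M \<eta>"
proof -
  have cdf: "M.prob {\<omega> \<in> space M. \<forall>t\<in>S. \<eta> (t + h) \<omega> \<le> ereal (y t)} = exp (- enn2real (exponent S y))"
    if "finite S" for S y h
    using \<eta>_cdf[of "(\<lambda>t. t + h) ` S" "\<lambda>u. y (u - h)"] that by (simp add: exponent_shift)
  have "stoch_process M (\<lambda>t. \<eta> (t + h))" for h
    by (simp add: stoch_process_def M.prob_space_axioms)
  then show ?thesis
    unfolding stationary_process_def by (intro allI same_law_erealI) (simp_all add: cdf)
qed

lemma \<eta>_gumbel: "standard_gumbel M (\<eta> t)"
  unfolding standard_gumbel_def
  using \<eta>_cdf[of "{t}"] by (auto simp: exponent_singleton)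

lemma \<eta>_max_stable: "max_stable TYPE('c) M \<eta>"
  unfolding max_stable_def
proof (intro conjI \<eta>_process allI impI)
  fix n :: nat and N :: "'c measure" and Y
  assume n: "1 \<le> n" and Y: "indep_copies N {..<n} Y M \<eta>"
  interpret N: prob_space N using Y by (simp add: indep_copies_def)
  have law: "same_law N (Y k) M \<eta>" if "k < n" for k using Y that by (simp add: indep_copies_def)
  then have Y_meas: "Y k t \<in> borel_measurable N" if "k < n" for k t
    using that by (simp add: same_law_def stoch_process_def)
  show "same_law N (\<lambda>t \<omega>. SUP k\<in>{..<n}. Y k t \<omega>) M (\<lambda>t \<omega>. \<eta> t \<omega> + ereal (ln (real n)))"
  proof (rule same_law_erealI)
    show "stoch_process N (\<lambda>t \<omega>. SUP k\<in>{..<n}. Y k t \<omega>)"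
      unfolding stoch_process_def using Y_meas
      by (auto intro!: N.prob_space_axioms borel_measurable_SUP)
    show "stoch_process M (\<lambda>t \<omega>. \<eta> t \<omega> + ereal (ln (real n)))"
      unfolding stoch_process_def by (auto intro: M.prob_space_axioms)
    fix S :: "'t set" and y assume S: "finite S"
    have add_le: "x + ereal c \<le> ereal b \<longleftrightarrow> x \<le> ereal (b - c)" for x :: ereal and b c
      by (cases x) auto
    \<comment> \<open>The copies are independent as maps into the full product space, so the
      constraint on the finite set \<open>S\<close> is phrased as a measurable set of whole
      paths.\<close>
    define B where "B = {f \<in> space (Pi\<^sub>M UNIV (\<lambda>_. borel :: ereal measure)). \<forall>t\<in>S. f t \<le> ereal (y t)}"
    have B: "B \<in> sets (Pi\<^sub>M UNIV (\<lambda>_. borel))"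
      unfolding B_def by (intro sets.sets_Collect_finite_All S) measurable
    have "{\<omega> \<in> space N. \<forall>t\<in>S. (SUP k\<in>{..<n}. Y k t \<omega>) \<le> ereal (y t)}
      = (\<Inter>k\<in>{..<n}. (\<lambda>\<omega> t. Y k t \<omega>) -` B \<inter> space N)"
      using n by (auto simp: B_def SUP_le_iff space_PiM Suc_le_eq)
    moreover have "N.prob (\<Inter>k\<in>{..<n}. (\<lambda>\<omega> t. Y k t \<omega>) -` B \<inter> space N)
      = (\<Prod>k<n. N.prob ((\<lambda>\<omega> t. Y k t \<omega>) -` B \<inter> space N))"
    proof (rule N.indep_varsD_finite)
      show "N.indep_vars (\<lambda>_. Pi\<^sub>M UNIV (\<lambda>_. borel)) (\<lambda>k \<omega> t. Y k t \<omega>) {..<n}"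
        using Y by (simp add: indep_copies_def)
    qed (use n B in \<open>auto simp: lessThan_empty_iff\<close>)
    ultimately have "N.prob {\<omega> \<in> space N. \<forall>t\<in>S. (SUP k\<in>{..<n}. Y k t \<omega>) \<le> ereal (y t)}
      = (\<Prod>k<n. N.prob ((\<lambda>\<omega> t. Y k t \<omega>) -` B \<inter> space N))"
      by simp
    also have "\<dots> = (\<Prod>k<n. exp (- enn2real (exponent S y)))"
    proof (intro prod.cong refl)
      fix k assume "k \<in> {..<n}"
      moreover have "(\<lambda>\<omega> t. Y k t \<omega>) -` B \<inter> space N = {\<omega> \<in> space N. \<forall>t\<in>S. Y k t \<omega> \<le> ereal (y t)}"
        by (auto simp: B_def space_PiM)
      ultimately show "N.prob ((\<lambda>\<omega> t. Y k t \<omega>) -` B \<inter> space N) = exp (- enn2real (exponent S y))"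
        using same_law_prob_box[OF law S] by (simp add: \<eta>_cdf[OF S])
    qed
    also have "\<dots> = exp (- (real n * enn2real (exponent S y)))"
      by (simp add: exp_of_nat_mult[symmetric])
    \<comment> \<open>Homogeneity trades the factor \<open>n\<close> for a shift of all bounds by
      \<open>ln n\<close>.\<close>
    also have "\<dots> = exp (- enn2real (exponent S (\<lambda>t. y t - ln (real n))))"
      using n S by (simp add: exponent_scale enn2real_mult)
    also have "\<dots> = M.prob {\<omega> \<in> space M. \<forall>t\<in>S. \<eta> t \<omega> \<le> ereal (y t - ln (real n))}"
      by (simp only: \<eta>_cdf[OF S])
    also have "{\<omega> \<in> space M. \<forall>t\<in>S. \<eta> t \<omega> \<le> ereal (y t - ln (real n))}
      = {\<omega> \<in> space M. \<forall>t\<in>S. \<eta> t \<omega> + ereal (ln (real n)) \<le> ereal (y t)}"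
      by (simp add: add_le)
    finally show "N.prob {\<omega> \<in> space N. \<forall>t\<in>S. (SUP k\<in>{..<n}. Y k t \<omega>) \<le> ereal (y t)}
      = M.prob {\<omega> \<in> space M. \<forall>t\<in>S. \<eta> t \<omega> + ereal (ln (real n)) \<le> ereal (y t)}" .
  qed
qed

end

text \<open>The second moment of the increment between \<open>t\<close> and \<open>s\<close> is the
  variogram at \<open>s - t\<close> for both processes. A common variogram thus gives equal
  exponents, hence equal probabilities of all real boxes.\<close>

lemma brown_resnick_same_law:
  assumes "brown_resnick P W M V U" "brown_resnick P' W' M' V' U'" and eq: "variogram P' W' = variogram P W"
  shows "same_law M (sup_process P W U V) M' (sup_process P' W' U' V')"
proof -
  interpret A: brown_resnick P W M V U by fact
  interpret B: brown_resnick P' W' M' V' U' by fact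
  have "A.exponent S y = B.exponent S y" if "finite S" for S y
    unfolding A.exponent_def B.exponent_def
    using centered_gaussian_si_increment[OF A.W] centered_gaussian_si_increment[OF B.W]
    by (intro gaussian_sup_exp_eq A.W_gaussian A.W_centered B.W_gaussian B.W_centered that) (simp add: eq)
  then show ?thesis
    by (intro same_law_erealI A.\<eta>_process B.\<eta>_process) (simp add: A.\<eta>_cdf B.\<eta>_cdf)
qed

theorem theorem2:
  fixes P :: "'p measure" and W :: "real ^ 'd \<Rightarrow> 'p \<Rightarrow> real"
    and M :: "'a measure" and V :: "nat \<Rightarrow> real ^ 'd \<Rightarrow> 'a \<Rightarrow> real" and U :: "nat \<Rightarrow> 'a \<Rightarrow> real"
  assumes "centered_gaussian_si P W"
    and "indep_copies M UNIV V P W"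
    and "poisson_point_process M U exp_intensity"
    and "prob_space.indep_set M (process_algebra M U) (process_algebra M (\<lambda>(i, t). V i t))"
  shows "stationary_process M (sup_process P W U V) \<and>
    max_stable TYPE('c) M (sup_process P W U V) \<and>
    (\<forall>t. standard_gumbel M (sup_process P W U V t)) \<and>
    (\<forall>(P' :: 'q measure) (W' :: real ^ 'd \<Rightarrow> 'q \<Rightarrow> real)
        (M' :: 'b measure) (V' :: nat \<Rightarrow> real ^ 'd \<Rightarrow> 'b \<Rightarrow> real) (U' :: nat \<Rightarrow> 'b \<Rightarrow> real).
      centered_gaussian_si P' W' \<and>
      indep_copies M' UNIV V' P' W' \<and>
      poisson_point_process M' U' exp_intensity \<and>
      prob_space.indep_set M' (process_algebra M' U') (process_algebra M' (\<lambda>(i, t). V' i t)) \<and>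
      variogram P' W' = variogram P W \<longrightarrow>
      same_law M (sup_process P W U V) M' (sup_process P' W' U' V'))"
proof -
  interpret brown_resnick P W M V U by unfold_locales (fact assms)+
  have "same_law M (sup_process P W U V) M' (sup_process P' W' U' V')"
    if "centered_gaussian_si P' W'" "indep_copies M' UNIV V' P' W'" "poisson_point_process M' U' exp_intensity"
      "prob_space.indep_set M' (process_algebra M' U') (process_algebra M' (\<lambda>(i, t). V' i t))"
      "variogram P' W' = variogram P W"
    for P' :: "'q measure" and W' :: "real ^ 'd \<Rightarrow> 'q \<Rightarrow> real"
      and M' :: "'b measure" and V' :: "nat \<Rightarrow> real ^ 'd \<Rightarrow> 'b \<Rightarrow> real" and U' :: "nat \<Rightarrow> 'b \<Rightarrow> real"
    by (rule brown_resnick_same_law[OF brown_resnick_axioms brown_resnick.intro]) (fact that)+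
  then show ?thesis
    by (intro conjI allI impI \<eta>_stationary \<eta>_max_stable \<eta>_gumbel) (elim conjE)
qed

end
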